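(* Let $p\geq 1$ and let $\mu$ be a $p\times p$ general closed interval matrix. Then $\mu$ is full-rank if and only if the following three conditions hold: (1) for every $i,j$ such that $\mu_{i,j}=(-\infty,+\infty)$, in the matrix $\mu_{\hat i,\hat j}$ there is no totally nonconstant pg-diagonal of length $p-1$, and the complementary matrix of every totally nonconstant pg-diagonal in $\mu_{\hat i,\hat j}$ of length between $0$ and $p-2$ has $\det^c$ equal to $0$; (2) for every vertex matrix $A$ of even type of $\overline{\tilde\mu}$, the product $\det(A)\cdot\det\big((\overline{\tilde\mu})_l\big)$ is positive; (3) for every vertex matrix $\gamma$ of even type of $\tilde\mu$ and every $s\ge 1$ and $(i_1,j_1),\ldots,(i_s,j_s)\in\{1,\ldots,p\}\times\{1,\ldots,p\}$ such that $i_1,\ldots,i_s$ are distinct, $j_1,\ldots,j_s$ are distinct and $\mu_{i_1,j_1},\ldots,\mu_{i_s,j_s}$ are half-bounded, we have $$(-1)^{i_1+j_1+\widetilde{i_2}+\widetilde{j_2}+\cdots+\widetilde{i_s}+\widetilde{j_s}+\chi((i_1,j_1),\ldots,(i_s,j_s))}\,\det\big((\overline{\tilde\mu})_l\big)\,\det\big(\overline{\gamma}_{\widehat{i_1,\ldots,i_s},\widehat{j_1,\ldots,j_s}}\big)\geq 0,$$ where the determinant of a $0\times 0$ matrix is defined to be $1$; $\chi((i_1,j_1),\ldots,(i_s,j_s))$ is the number of right-bounded intervals among $\mu_{i_1,j_1},\ldots,\mu_{i_s,j_s}$; and, for $t=2,\ldots,s$, $\widetilde{i_t}:=i_t-\#\{r\in\{1,\ldots,t-1\}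 : i_r<i_t\}$ and $\widetilde{j_t}:=j_t-\#\{r\in\{1,\ldots,t-1\} : j_r<j_t\}$.
   Context: A general closed interval matrix is a matrix whose entries are closed connected nonempty subsets of $\mathbb{R}$. A real matrix $A$ of the same size is contained in $\mu$ (written $A\in\mu$) if $A_{i,j}\in\mu_{i,j}$ for all $i,j$. A $p\times q$ general closed interval matrix is full-rank if every real matrix contained in it has rank $\min\{p,q\}$ (for a square one: every matrix contained in it is nonsingular). Types of entries: an entry is constant if it is a one-element subset of $\mathbb{R}$ (identified with that real number); bounded if it equals $[a,b]$ for some real $a\le b$ (constants are bounded); half-bounded if it equals $[a,+\infty)$ (left-bounded) or $(-\infty,a]$ (right-bounded) for some $a\in\mathbb{R}$. Submatrices: $\mu_{\widehat{i_1,\ldots,i_s},\widehat{j_1,\ldots,j_s}}$ is obtained from $\mu$ by deleting rows $i_1,\ldots,i_s$ and columns $j_1,\ldots,j_s$; in particular $\mu_{\hat i,\hat j}$ is obtained by deleting row $i$ and column $j$. Derived matrices: $\tilde\mu$ is obtained from $\mu$ by replacing each entry $(-\infty,+\infty)$ with $0$. $\overline{\mu}$ is obtained from $\mu$ by replacing each entry of the form $[a,+\infty)$ with $a$ and each entry of the form $(-\infty,b]$ with $b$. $\mu_l$ is obtained from $\mu$ by replacing each entry of the form $[a,b]$ (with $a\le b$ real) with $a$. Thus $(\overline{\tilde\mu})_l$ is obtained by applying first $\tilde{\ }$, then $\overline{\ }$, then ${}_l$; it is a real matrix. For a vertex matrix $\gamma$ of $\tilde\mu$ (defined below), $\overline\gamma$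 is a real matrix. Pg-diagonals: for a square general closed interval matrix $\nu$ of size $n\times n$, a partial generalized diagonal (pg-diagonal) of length $k$ is a $k$-tuple $(\nu_{i_1,j_1},\ldots,\nu_{i_k,j_k})$ with $i_1,\ldots,i_k\in\{1,\ldots,n\}$ distinct and $j_1,\ldots,j_k\in\{1,\ldots,n\}$ distinct. Its complementary matrix is the submatrix of $\nu$ formed by the rows with index not in $\{i_1,\ldots,i_k\}$ and the columns with index not in $\{j_1,\ldots,j_k\}$ (so for $k=0$ it is $\nu$). A pg-diagonal is totally nonconstant if none of its entries is constant. Define $$\det{}^c(\nu)=\sum_{\sigma}\epsilon(\sigma)\,\nu_{1,\sigma(1)}\cdots\nu_{n,\sigma(n)},$$ where the sum is over the permutations $\sigma$ of $\{1,\ldots,n\}$ such that $\nu_{1,\sigma(1)},\ldots,\nu_{n,\sigma(n)}$ are all constant and $\epsilon(\sigma)$ is the sign of $\sigma$; $\det^c(\nu)=0$ if there is no such $\sigma$. Vertex matrices: a vertex matrix of a general closed interval matrix $\nu$ is a matrix $\gamma$ of the same size such that $\gamma_{i,j}\in\{m_{i,j},M_{i,j}\}$ whenever $\nu_{i,j}=[m_{i,j},M_{i,j}]$ is bounded, and $\gamma_{i,j}=\nu_{i,j}$ otherwise. A vertex matrix $\gamma$ of $\nu$ is of even type if for every $2\times 2$ submatrix of $\nu$ all of whose entries are bounded, either some entry of this submatrix of $\nu$ is constant, or the number of entries of the corresponding submatrix of $\gamma$ that are equal to the minimum of the corresponding entry of $\nu$ is even. *)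

theory Defs
  imports "Jordan_Normal_Form.DL_Rank" "Jordan_Normal_Form.DL_Submatrix"
begin

(* A general closed interval matrix is a matrix of type "real set mat"; a real number a is
   identified with the constant entry {a}. Rows and columns are numbered from 0. *)

definition constant_entry :: "real set \<Rightarrow> bool" where
  "constant_entry S \<longleftrightarrow> (\<exists>a. S = {a})"

definition bounded_entry :: "real set \<Rightarrow> bool" where
  "bounded_entry S \<longleftrightarrow> (\<exists>a b. a \<le> b \<and> S = {a..b})"

definition left_bounded_entry :: "real set \<Rightarrow> bool" where
  "left_bounded_entry S \<longleftrightarrow> (\<exists>a. S = {a..})"

definition right_bounded_entry :: "real set \<Rightarrow> bool" where
  "right_bounded_entry S \<longleftrightarrow> (\<exists>a. S = {..a})"

definition half_bounded_entry :: "real set \<Rightarrow> bool" where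
  "half_bounded_entry S \<longleftrightarrow> left_bounded_entry S \<or> right_bounded_entry S"

definition general_closed_interval_mat :: "real set mat \<Rightarrow> bool" where
  "general_closed_interval_mat \<mu> \<longleftrightarrow>
     (\<forall>S \<in> elements_mat \<mu>. closed S \<and> connected S \<and> S \<noteq> {})"

definition contained_in_mat :: "real mat \<Rightarrow> real set mat \<Rightarrow> bool" where
  "contained_in_mat A \<mu> \<longleftrightarrow> dim_row A = dim_row \<mu> \<and> dim_col A = dim_col \<mu> \<and>
     (\<forall>i < dim_row \<mu>. \<forall>j < dim_col \<mu>. A $$ (i,j) \<in> \<mu> $$ (i,j))"

definition full_rank_mat :: "real set mat \<Rightarrow> bool" where
  "full_rank_mat \<mu> \<longleftrightarrow>
     (\<forall>A. contained_in_mat A \<mu> \<longrightarrow>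
        vec_space.rank (dim_row A) A = min (dim_row \<mu>) (dim_col \<mu>))"

definition delete_rows_cols :: "'a mat \<Rightarrow> nat set \<Rightarrow> nat set \<Rightarrow> 'a mat" where
  "delete_rows_cols A I J = submatrix A (- I) (- J)"

definition tilde_mat :: "real set mat \<Rightarrow> real set mat" where
  "tilde_mat = map_mat (\<lambda>S. if S = UNIV then {0} else S)"

definition bar_mat :: "real set mat \<Rightarrow> real set mat" where
  "bar_mat = map_mat (\<lambda>S. if left_bounded_entry S then {Inf S}
                           else if right_bounded_entry S then {Sup S} else S)"

definition lower_mat :: "real set mat \<Rightarrow> real set mat" where
  "lower_mat = map_mat (\<lambda>S. if bounded_entry S then {Inf S} else S)"

(* The real matrix identified with an interval matrix all of whose entries are constant;
   meaningful only for such matrices. *)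
definition real_mat :: "real set mat \<Rightarrow> real mat" where
  "real_mat = map_mat the_elem"

(* A pg-diagonal is given by the list of its positions (i_1,j_1),...,(i_k,j_k);
   its length is the length of the list. *)
definition pg_diagonal :: "real set mat \<Rightarrow> (nat \<times> nat) list \<Rightarrow> bool" where
  "pg_diagonal \<nu> ps \<longleftrightarrow> distinct (map fst ps) \<and> distinct (map snd ps) \<and>
     (\<forall>(i,j) \<in> set ps. i < dim_row \<nu> \<and> j < dim_col \<nu>)"

definition complementary_mat :: "real set mat \<Rightarrow> (nat \<times> nat) list \<Rightarrow> real set mat" where
  "complementary_mat \<nu> ps = delete_rows_cols \<nu> (set (map fst ps)) (set (map snd ps))"

definition totally_nonconstant :: "real set mat \<Rightarrow> (nat \<times> nat) list \<Rightarrow> bool" where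
  "totally_nonconstant \<nu> ps \<longleftrightarrow> (\<forall>(i,j) \<in> set ps. \<not> constant_entry (\<nu> $$ (i,j)))"

definition detc :: "real set mat \<Rightarrow> real" where
  "detc \<nu> = (\<Sum>\<sigma> | \<sigma> permutes {0..<dim_row \<nu>} \<and>
                      (\<forall>i < dim_row \<nu>. constant_entry (\<nu> $$ (i, \<sigma> i))).
               of_int (sign \<sigma>) * (\<Prod>i = 0..<dim_row \<nu>. the_elem (\<nu> $$ (i, \<sigma> i))))"

definition vertex_mat :: "real set mat \<Rightarrow> real set mat \<Rightarrow> bool" where
  "vertex_mat \<nu> \<gamma> \<longleftrightarrow> dim_row \<gamma> = dim_row \<nu> \<and> dim_col \<gamma> = dim_col \<nu> \<and>
     (\<forall>i < dim_row \<nu>. \<forall>j < dim_col \<nu>.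
        (\<forall>m M. m \<le> M \<and> \<nu> $$ (i,j) = {m..M} \<longrightarrow> \<gamma> $$ (i,j) \<in> {{m}, {M}}) \<and>
        (\<not> bounded_entry (\<nu> $$ (i,j)) \<longrightarrow> \<gamma> $$ (i,j) = \<nu> $$ (i,j)))"

definition even_type :: "real set mat \<Rightarrow> real set mat \<Rightarrow> bool" where
  "even_type \<nu> \<gamma> \<longleftrightarrow>
     (\<forall>i i' j j'. i < i' \<and> i' < dim_row \<nu> \<and> j < j' \<and> j' < dim_col \<nu> \<and>
        (\<forall>ab \<in> {i,i'} \<times> {j,j'}. bounded_entry (\<nu> $$ ab)) \<longrightarrow>
        (\<exists>ab \<in> {i,i'} \<times> {j,j'}. constant_entry (\<nu> $$ ab)) \<or>
        even (card {ab \<in> {i,i'} \<times> {j,j'}. \<gamma> $$ ab = {Inf (\<nu> $$ ab)}}))"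

definition num_right_bounded :: "real set mat \<Rightarrow> (nat \<times> nat) list \<Rightarrow> nat" where
  "num_right_bounded \<mu> ps = card {t. t < length ps \<and> right_bounded_entry (\<mu> $$ (ps ! t))}"

(* The number x_t - #{r < t. x_r < x_t}. For a list of distinct naturals the subtraction is
   not truncated, because at most x_t distinct naturals are smaller than x_t. *)
definition shifted_index :: "nat list \<Rightarrow> nat \<Rightarrow> nat" where
  "shifted_index xs t = xs ! t - card {r. r < t \<and> xs ! r < xs ! t}"

(* Counting rows and columns from 1 would increase each of the length ps summand pairs
   (row index + column index) by 2, so the parity of the exponent is the same. *)
definition sign_exponent :: "real set mat \<Rightarrow> (nat \<times> nat) list \<Rightarrow> nat" where
  "sign_exponent \<mu> ps =
     fst (ps ! 0) + snd (ps ! 0) +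
     (\<Sum>t = 1..<length ps. shifted_index (map fst ps) t + shifted_index (map snd ps) t) +
     num_right_bounded \<mu> ps"

end

theory Submission
  imports Defs
begin

text \<open>
  The set of matrices contained in \<open>\<mu>\<close> is convex, so \<open>\<mu>\<close> has full rank iff the determinant does not vanish on
  it, and then the determinant has constant sign. An unbounded entry forces its cofactor to vanish on all of
  \<open>\<mu>\<close>; the cofactor is a multi-affine polynomial in the nonconstant entries, and its coefficients are the
  \<open>det\<^sup>c\<close> of the complementary matrices of pg-diagonals. A half-bounded entry is an endpoint plus a signed
  nonnegative parameter, and letting parameters tend to infinity one at a time shows that the coefficients of
  the determinant in these parameters are nonnegative up to the sign of the determinant.

  Conversely, let \<open>A x = 0\<close> with \<open>A\<close> contained in \<open>\<mu>\<close> and \<open>x \<noteq> 0\<close>, where the unbounded entries are \<open>0\<close>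
  without loss of generality. Keep the half-bounded entries of \<open>A\<close> and push all bounded entries of a row to
  the endpoints that maximise, respectively minimise, its product with \<open>x\<close>. A convex combination of the two
  resulting rows still annihilates \<open>x\<close>. So a matrix whose rows are such combinations is singular, although its
  determinant is a convex combination of determinants of matrices at even-type vertices, all of the same sign
  by the conditions on vertices and on coefficients.
\<close>

section \<open>Determinants with rows replaced by unit vectors\<close>

text \<open>If no row occurs twice in \<open>P\<close>, the rows occurring in \<open>P\<close>
  become unit vectors, and \<open>det (unit_rows A P)\<close> is the mixed partial derivative of the
  determinant in the entries at \<open>P\<close>: a signed minor, or 0 if a column repeats.\<close>

definition unit_rows :: "real mat \<Rightarrow> (nat \<times> nat) set \<Rightarrow> real mat" where
  "unit_rows A P = mat (dim_row A) (dim_col A)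
     (\<lambda>(r,c). if r \<in> fst ` P then (if (r,c) \<in> P then 1 else 0) else A $$ (r,c))"

definition upd_mat :: "real mat \<Rightarrow> nat \<times> nat \<Rightarrow> real \<Rightarrow> real mat" where
  "upd_mat A x v = mat (dim_row A) (dim_col A) (\<lambda>y. if y = x then v else A $$ y)"

definition add_on :: "real mat \<Rightarrow> (nat \<times> nat \<Rightarrow> real) \<Rightarrow> (nat \<times> nat) set \<Rightarrow> real mat" where
  "add_on A T H = mat (dim_row A) (dim_col A) (\<lambda>x. A $$ x + (if x \<in> H then T x else 0))"

lemma unit_rows_carrier [simp]: "unit_rows A P \<in> carrier_mat n m \<longleftrightarrow> A \<in> carrier_mat n m"
  unfolding carrier_mat_def unit_rows_def by simp

lemma upd_mat_carrier [simp]: "upd_mat A x v \<in> carrier_mat n m \<longleftrightarrow> A \<in> carrier_mat n m"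
  unfolding carrier_mat_def upd_mat_def by simp

lemma add_on_carrier [simp]: "add_on A T H \<in> carrier_mat n m \<longleftrightarrow> A \<in> carrier_mat n m"
  unfolding carrier_mat_def add_on_def by simp

lemma unit_rows_empty [simp]: "unit_rows A {} = A"
  by (auto simp: unit_rows_def)

lemma unit_rows_unit_rows:
  assumes "fst ` P \<inter> fst ` Q = {}"
  shows "unit_rows (unit_rows A P) Q = unit_rows A (P \<union> Q)"
proof (rule eq_matI)
  fix i j
  assume ij: "i < dim_row (unit_rows A (P \<union> Q))" "j < dim_col (unit_rows A (P \<union> Q))"
  have "(i,j) \<notin> P" if "i \<in> fst ` Q"
    using assms that by force
  moreover have "(i,j) \<notin> Q" if "i \<in> fst ` P"
    using assms that by force
  ultimately show "unit_rows (unit_rows A P) Q $$ (i,j) = unit_rows A (P \<union> Q) $$ (i,j)"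
    using assms ij by (simp add: unit_rows_def image_Un)
qed (simp_all add: unit_rows_def)

lemma unit_rows_upd_mat:
  assumes "fst x \<notin> fst ` P"
  shows "unit_rows (upd_mat A x v) P = upd_mat (unit_rows A P) x v"
  using assms by (intro eq_matI) (auto simp: unit_rows_def upd_mat_def image_iff Ball_def)

text \<open>Laplace expansion along row \<open>r\<close>: its cofactors ignore that row, so the
  three matrices share them.\<close>

lemma det_row_linear:
  fixes A B C :: "'a :: comm_ring_1 mat"
  assumes A: "A \<in> carrier_mat n n" and B: "B \<in> carrier_mat n n" and C: "C \<in> carrier_mat n n"
    and r: "r < n"
    and row: "\<And>j. j < n \<Longrightarrow> A $$ (r,j) = a * B $$ (r,j) + b * C $$ (r,j)"
    and rest: "\<And>i j. \<lbrakk>i < n; j < n; i \<noteq> r\<rbrakk> \<Longrightarrow> B $$ (i,j) = A $$ (i,j) \<and> C $$ (i,j) = A $$ (i,j)"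
  shows "det A = a * det B + b * det C"
proof -
  have del: "mat_delete B r j = mat_delete A r j" "mat_delete C r j = mat_delete A r j" if "j < n" for j
    using A B C r rest that by (auto simp: mat_delete_def)
  have "det A = (\<Sum>j<n. (a * B $$ (r,j) + b * C $$ (r,j)) * cofactor A r j)"
    using laplace_expansion_row[OF A r] row by simp
  also have "\<dots> = a * (\<Sum>j<n. B $$ (r,j) * cofactor B r j) + b * (\<Sum>j<n. C $$ (r,j) * cofactor C r j)"
    by (simp add: cofactor_def del sum_distrib_left sum.distrib algebra_simps)
  finally show ?thesis
    using laplace_expansion_row[OF B r] laplace_expansion_row[OF C r] by simp
qed

text \<open>The new row is the old one plus \<open>v - A $$ x\<close> times a unit vector. So the
  determinant is affine in each entry, and the slope is the cofactor in the form
  \<open>det (unit_rows A {x})\<close>.\<close>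

lemma det_upd_mat:
  assumes A: "A \<in> carrier_mat n n" and x: "x \<in> {0..<n} \<times> {0..<n}"
  shows "det (upd_mat A x v) = det A + (v - A $$ x) * det (unit_rows A {x})"
proof -
  obtain r c where rc: "x = (r,c)" "r < n" "c < n"
    using x by auto
  have "det (upd_mat A x v) = 1 * det A + (v - A $$ x) * det (unit_rows A {x})"
    by (rule det_row_linear[where r = r and n = n])
      (use A rc in \<open>auto simp: upd_mat_def unit_rows_def\<close>)
  then show ?thesis by simp
qed

text \<open>Two rows of the matrix become the same unit vector.\<close>

lemma det_unit_rows_same_col:
  assumes A: "A \<in> carrier_mat n n" and P: "P \<subseteq> {0..<n} \<times> {0..<n}" "inj_on fst P" "\<not> inj_on snd P"
  shows "det (unit_rows A P) = 0"
proof -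
  obtain r r' c where rc: "(r,c) \<in> P" "(r',c) \<in> P" "r \<noteq> r'"
    using P(3) unfolding inj_on_def by force
  have row_unit: "(a,b) \<in> P \<longleftrightarrow> b = c" if "a \<in> {r,r'}" for a b
    using that rc P(2) unfolding inj_on_def by fastforce
  have lt: "r < n" "r' < n"
    using rc P(1) by auto
  have "row (unit_rows A P) r = row (unit_rows A P) r'"
  proof (rule eq_vecI)
    fix b assume "b < dim_vec (row (unit_rows A P) r')"
    then have b: "b < n" using A by (simp add: unit_rows_def)
    have "r \<in> fst ` P" "r' \<in> fst ` P"
      using rc by force+
    then show "row (unit_rows A P) r $ b = row (unit_rows A P) r' $ b"
      using A lt b row_unit[of r b] row_unit[of r' b] by (simp add: unit_rows_def)
  qed (simp add: unit_rows_def)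
  then show ?thesis
    using A lt rc by (intro det_identical_rows[of _ n r r']) auto
qed

text \<open>Taylor expansion of the multi-affine polynomial \<open>det\<close> at \<open>A\<close>.
  Entries of one row never multiply each other, hence \<open>inj_on fst P\<close>; sets with a
  repeated column stay in the sum with coefficient 0.\<close>

lemma det_add_on:
  fixes A :: "real mat"
  assumes "finite H" and "H \<subseteq> {0..<n} \<times> {0..<n}" and "A \<in> carrier_mat n n"
  shows "det (add_on A T H) = (\<Sum>P | P \<subseteq> H \<and> inj_on fst P. prod T P * det (unit_rows A P))"
  using assms
proof (induction H arbitrary: A rule: finite_psubset_induct)
  case (psubset H)
  show ?case
  proof (cases "H = {}")
    case True
    have "add_on A T {} = A"
      by (intro eq_matI) (auto simp: add_on_def)
    moreover have "{P. P \<subseteq> {} \<and> inj_on fst P} = {{} :: (nat \<times> nat) set}"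
      by auto
    ultimately show ?thesis
      unfolding True by simp
  next
    case False
    then obtain x where x: "x \<in> H" by auto
    \<comment> \<open>\<open>H1\<close> serves the value without the increment at \<open>x\<close>.
      \<open>H2\<close> serves the slope there: the row of \<open>x\<close> is then a unit vector,
      so all increments in that row are lost.\<close>
    define H1 where "H1 = H - {x}"
    define H2 where "H2 = {y \<in> H. fst y \<noteq> fst x}"
    have sub: "H1 \<subset> H" "H2 \<subset> H" "x \<notin> H1" "x \<notin> H2"
      using x unfolding H1_def H2_def by blast+
    have fin: "finite H1" "finite H2"
      using psubset.hyps unfolding H1_def H2_def by simp_all
    have n: "x \<in> {0..<n} \<times> {0..<n}" "H1 \<subseteq> {0..<n} \<times> {0..<n}" "H2 \<subseteq> {0..<n} \<times> {0..<n}"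
      using x psubset.prems(1) unfolding H1_def H2_def by auto
    have upd: "add_on A T H = upd_mat (add_on A T H1) x (A $$ x + T x)"
      using x by (intro eq_matI) (auto simp: add_on_def upd_mat_def H1_def)
    have unit: "unit_rows (add_on A T H1) {x} = add_on (unit_rows A {x}) T H2"
      using n by (intro eq_matI) (auto simp: add_on_def unit_rows_def H1_def H2_def)
    have entry: "add_on A T H1 $$ x = A $$ x"
      using n(1) sub(3) psubset.prems(2) by (auto simp: add_on_def)
    have "det (add_on A T H) = det (add_on A T H1) + T x * det (add_on (unit_rows A {x}) T H2)"
      unfolding upd using n(1) psubset.prems(2) by (subst det_upd_mat[where n = n]) (simp_all add: unit entry)
    also have "det (add_on A T H1) = (\<Sum>P | P \<subseteq> H1 \<and> inj_on fst P. prod T P * det (unit_rows A P))"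
      by (rule psubset.IH[OF sub(1) n(2) psubset.prems(2)])
    also have "det (add_on (unit_rows A {x}) T H2) =
        (\<Sum>P | P \<subseteq> H2 \<and> inj_on fst P. prod T P * det (unit_rows (unit_rows A {x}) P))"
      by (rule psubset.IH[OF sub(2) n(3)]) (simp add: psubset.prems(2))
    also have "T x * \<dots> = (\<Sum>P | P \<subseteq> H2 \<and> inj_on fst P. prod T (insert x P) * det (unit_rows A (insert x P)))"
      unfolding sum_distrib_left
    proof (rule sum.cong[OF refl])
      fix P assume "P \<in> {P. P \<subseteq> H2 \<and> inj_on fst P}"
      then have P: "P \<subseteq> H2" by auto
      then have "finite P" "x \<notin> P" "fst ` {x} \<inter> fst ` P = {}"
        using fin(2) sub(4) finite_subset by (blast, blast, auto simp: H2_def)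
      then show "T x * (prod T P * det (unit_rows (unit_rows A {x}) P)) =
          prod T (insert x P) * det (unit_rows A (insert x P))"
        by (simp add: unit_rows_unit_rows)
    qed
    also have "\<dots> = (\<Sum>P \<in> insert x ` {P. P \<subseteq> H2 \<and> inj_on fst P}. prod T P * det (unit_rows A P))"
    proof (subst sum.reindex)
      show "inj_on (insert x) {P. P \<subseteq> H2 \<and> inj_on fst P}"
      proof (rule inj_onI)
        fix P Q assume "P \<in> {P. P \<subseteq> H2 \<and> inj_on fst P}" "Q \<in> {P. P \<subseteq> H2 \<and> inj_on fst P}"
          and eq: "insert x P = insert x Q"
        then have "x \<notin> P" "x \<notin> Q"
          using sub(4) by blast+
        then show "P = Q"
          using eq by (simp add: insert_ident)
      qed
    qed simp
    also have "(\<Sum>P | P \<subseteq> H1 \<and> inj_on fst P. prod T P * det (unit_rows A P)) +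
         (\<Sum>P \<in> insert x ` {P. P \<subseteq> H2 \<and> inj_on fst P}. prod T P * det (unit_rows A P)) =
         (\<Sum>P \<in> {P. P \<subseteq> H1 \<and> inj_on fst P} \<union> insert x ` {P. P \<subseteq> H2 \<and> inj_on fst P}.
            prod T P * det (unit_rows A P))"
    proof (rule sum.union_disjoint[symmetric])
      show "finite {P. P \<subseteq> H1 \<and> inj_on fst P}" "finite (insert x ` {P. P \<subseteq> H2 \<and> inj_on fst P})"
        using fin by simp_all
      show "{P. P \<subseteq> H1 \<and> inj_on fst P} \<inter> insert x ` {P. P \<subseteq> H2 \<and> inj_on fst P} = {}"
        using sub(3) by blast
    qed
    also have "{P. P \<subseteq> H1 \<and> inj_on fst P} \<union> insert x ` {P. P \<subseteq> H2 \<and> inj_on fst P} =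
        {P. P \<subseteq> H \<and> inj_on fst P}"
    proof (intro equalityI subsetI)
      fix P assume "P \<in> {P. P \<subseteq> H1 \<and> inj_on fst P} \<union> insert x ` {P. P \<subseteq> H2 \<and> inj_on fst P}"
      then consider "P \<subseteq> H1" "inj_on fst P" | Q where "P = insert x Q" "Q \<subseteq> H2" "inj_on fst Q"
        by blast
      then show "P \<in> {P. P \<subseteq> H \<and> inj_on fst P}"
      proof cases
        case 1
        then show ?thesis using sub(1) by blast
      next
        case 2
        then have "fst x \<notin> fst ` (Q - {x})"
          by (auto simp: H2_def)
        moreover have "insert x Q \<subseteq> H"
          using 2 x sub(2) by blast
        ultimately show ?thesis
          using 2 by simp
      qed
    next
      fix P assume P: "P \<in> {P. P \<subseteq> H \<and> inj_on fst P}"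
      show "P \<in> {P. P \<subseteq> H1 \<and> inj_on fst P} \<union> insert x ` {P. P \<subseteq> H2 \<and> inj_on fst P}"
      proof (cases "x \<in> P")
        case True
        have "fst y \<noteq> fst x" if "y \<in> P - {x}" for y
          using P True that inj_onD[of fst P y x] by blast
        then have "P - {x} \<subseteq> H2"
          using P by (auto simp: H2_def)
        moreover have "inj_on fst (P - {x})"
          using P by (auto intro: inj_on_diff)
        moreover have "P = insert x (P - {x})"
          using True by blast
        ultimately show ?thesis by blast
      next
        case False
        then have "P \<subseteq> H1"
          using P by (auto simp: H1_def)
        then show ?thesis using P by blast
      qed
    qed
    finally show ?thesis .
  qed
qed

section \<open>Deleting rows and columns\<close>

lemma pick_eqI:
  assumes "infinite S" "x \<in> S" "card {a \<in> S. a < x} = k"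
  shows "pick S k = x"
  using assms pick_card_in_set by auto

text \<open>The position of an element is the number of its predecessors in the set. Elements below
  \<open>s\<close> keep this number, later ones lose one.\<close>

lemma pick_Diff_singleton:
  assumes S: "infinite S" and s: "s \<in> S"
  shows "pick (S - {s}) i = (if i < card {a \<in> S. a < s} then pick S i else pick S (Suc i))"
proof -
  define k where "k = card {a \<in> S. a < s}"
  have sk: "pick S k = s"
    using S s by (intro pick_eqI) (auto simp: k_def)
  have D: "infinite (S - {s})"
    using S by auto
  show ?thesis
  proof (cases "i < k")
    case True
    then have "pick S i < s"
      using pick_mono_inf[OF S] sk by auto
    then have "{a \<in> S - {s}. a < pick S i} = {a \<in> S. a < pick S i}"
      by auto
    then have "pick (S - {s}) i = pick S i"
      using card_pick_inf[OF S] pick_in_set_inf[OF S] \<open>pick S i < s\<close>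
      by (intro pick_eqI[OF D]) auto
    then show ?thesis
      using True by (simp add: k_def)
  next
    case False
    then have lt: "s < pick S (Suc i)"
      using pick_mono_inf[OF S, of k "Suc i"] sk by auto
    then have "{a \<in> S - {s}. a < pick S (Suc i)} = {a \<in> S. a < pick S (Suc i)} - {s}"
      by auto
    moreover have "s \<in> {a \<in> S. a < pick S (Suc i)}"
      using s lt by auto
    ultimately have "pick (S - {s}) i = pick S (Suc i)"
      using card_pick_inf[OF S, of "Suc i"] pick_in_set_inf[OF S, of "Suc i"] lt
      by (intro pick_eqI[OF D]) (auto simp del: pick.simps)
    then show ?thesis
      using False by (simp add: k_def)
  qed
qed

lemma delete_rows_cols_carrier:
  assumes "A \<in> carrier_mat n m" "I \<subseteq> {0..<n}" "J \<subseteq> {0..<m}"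
  shows "delete_rows_cols A I J \<in> carrier_mat (n - card I) (m - card J)"
proof -
  have "card {i. i < k \<and> i \<in> - K} = k - card K" if "K \<subseteq> {0..<k}" for k and K :: "nat set"
  proof -
    have "{i. i < k \<and> i \<in> - K} = {0..<k} - K"
      by auto
    then show ?thesis
      using that by (simp add: card_Diff_subset finite_subset)
  qed
  then show ?thesis
    using assms by (auto simp: delete_rows_cols_def dim_submatrix)
qed

lemma delete_rows_cols_index:
  assumes "A \<in> carrier_mat n m" "I \<subseteq> {0..<n}" "J \<subseteq> {0..<m}" "i < n - card I" "j < m - card J"
  shows "delete_rows_cols A I J $$ (i,j) = A $$ (pick (- I) i, pick (- J) j)"
    and "pick (- I) i < n" "pick (- I) i \<notin> I" "pick (- J) j < m" "pick (- J) j \<notin> J"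
proof -
  have c: "card {i. i < dim_row A \<and> i \<in> - I} = n - card I" "card {j. j < dim_col A \<and> j \<in> - J} = m - card J"
    using delete_rows_cols_carrier[OF assms(1-3)] by (auto simp: delete_rows_cols_def dim_submatrix)
  show "delete_rows_cols A I J $$ (i,j) = A $$ (pick (- I) i, pick (- J) j)"
    unfolding delete_rows_cols_def using assms c by (intro submatrix_index) auto
  show "pick (- I) i < n" "pick (- J) j < m"
    using pick_le[of i n "- I"] pick_le[of j m "- J"] c assms by auto
  have "finite I" "finite J"
    using assms finite_subset by blast+
  then have "infinite (- I)" "infinite (- J)"
    by (simp_all add: finite_compl)
  then show "pick (- I) i \<notin> I" "pick (- J) j \<notin> J"
    using pick_in_set_inf by blast+
qed

lemma delete_rows_cols_empty [simp]: "delete_rows_cols A {} {} = A"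
  by (intro eq_matI) (auto simp: delete_rows_cols_def submatrix_def pick_UNIV)

lemma card_Compl_less:
  fixes i :: nat
  shows "card {a \<in> - I. a < i} = i - card {a \<in> I. a < i}"
proof -
  have "{a \<in> - I. a < i} = {0..<i} - {a \<in> I. a < i}"
    by auto
  then show ?thesis
    by (simp add: card_Diff_subset subset_iff)
qed

text \<open>Lets a minor of a submatrix be read as a submatrix of \<open>A\<close>: row
  \<open>i\<close> of \<open>A\<close> sits at position \<open>card {a \<in> - I. a < i}\<close>
  once the rows in \<open>I\<close> are gone, and likewise for columns.\<close>

lemma mat_delete_delete_rows_cols:
  assumes A: "A \<in> carrier_mat n m" and I: "I \<subseteq> {0..<n}" "i < n" "i \<notin> I"
    and J: "J \<subseteq> {0..<m}" "j < m" "j \<notin> J"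
  shows "mat_delete (delete_rows_cols A I J) (card {a \<in> - I. a < i}) (card {a \<in> - J. a < j}) =
    delete_rows_cols A (insert i I) (insert j J)"
proof -
  have fin: "finite I" "finite J"
    using I J finite_subset by blast+
  then have inf: "infinite (- I)" "infinite (- J)"
    by (simp_all add: finite_compl)
  have sub: "insert i I \<subseteq> {0..<n}" "insert j J \<subseteq> {0..<m}"
    using I J by auto
  have card: "card (insert i I) = Suc (card I)" "card (insert j J) = Suc (card J)"
    using fin I J by auto
  note car = delete_rows_cols_carrier[OF A I(1) J(1)] delete_rows_cols_carrier[OF A sub]
  have eq: "- insert i I = - I - {i}" "- insert j J = - J - {j}"
    by auto
  show ?thesis
  proof (rule eq_matI)
    fix a b assume "a < dim_row (delete_rows_cols A (insert i I) (insert j J))"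
      "b < dim_col (delete_rows_cols A (insert i I) (insert j J))"
    then have ab: "a < n - Suc (card I)" "b < m - Suc (card J)"
      using car card by auto
    have "delete_rows_cols A (insert i I) (insert j J) $$ (a,b) =
        A $$ (pick (- insert i I) a, pick (- insert j J) b)"
      using ab card by (intro delete_rows_cols_index[OF A sub]) auto
    moreover have "pick (- insert i I) a =
        pick (- I) (if a < card {a \<in> - I. a < i} then a else Suc a)"
      "pick (- insert j J) b = pick (- J) (if b < card {a \<in> - J. a < j} then b else Suc b)"
      unfolding eq using inf I J by (simp_all add: pick_Diff_singleton)
    ultimately show "mat_delete (delete_rows_cols A I J) (card {a \<in> - I. a < i})
        (card {a \<in> - J. a < j}) $$ (a,b) = delete_rows_cols A (insert i I) (insert j J) $$ (a,b)"
      using ab car delete_rows_cols_index(1)[OF A I(1) J(1)]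
      by (auto simp: mat_delete_def)
  qed (use car card in auto)
qed

section \<open>Shifted indices and the signs of minors\<close>

lemma shifted_index_append:
  assumes "t < length xs"
  shows "shifted_index (xs @ ys) t = shifted_index xs t"
proof -
  have "{r. r < t \<and> (xs @ ys) ! r < (xs @ ys) ! t} = {r. r < t \<and> xs ! r < xs ! t}"
    using assms by (auto simp: nth_append)
  then show ?thesis
    using assms by (simp add: shifted_index_def nth_append)
qed

text \<open>The shifted index of the last element is its position among the indices left after
  deleting the earlier ones, so it is the index that a Laplace expansion meets.\<close>

lemma shifted_index_snoc:
  assumes "distinct xs"
  shows "shifted_index (xs @ [x]) (length xs) = card {a \<in> - set xs. a < x}"
proof -
  have "{a \<in> set xs. a < x} = (\<lambda>r. xs ! r) ` {r. r < length xs \<and> xs ! r < x}"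
    by (auto simp: in_set_conv_nth)
  moreover have "inj_on (\<lambda>r. xs ! r) {r. r < length xs \<and> xs ! r < x}"
    using assms by (auto simp: inj_on_def nth_eq_iff_index_eq)
  ultimately have "card {a \<in> set xs. a < x} = card {r. r < length xs \<and> xs ! r < x}"
    by (simp add: card_image)
  moreover have "{r. r < length xs \<and> (xs @ [x]) ! r < x} = {r. r < length xs \<and> xs ! r < x}"
    by (auto simp: nth_append)
  ultimately show ?thesis
    unfolding shifted_index_def card_Compl_less by simp
qed

lemma card_Compl_less_lt:
  fixes k :: nat
  assumes "K \<subseteq> {0..<n}" "k < n" "k \<notin> K"
  shows "card {a \<in> - K. a < k} < n - card K"
proof -
  have "{a \<in> - K. a < k} \<subset> {0..<n} - K"
    using assms by auto
  then have "card {a \<in> - K. a < k} < card ({0..<n} - K)"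
    by (intro psubset_card_mono) auto
  then show ?thesis
    using assms by (simp add: card_Diff_subset finite_subset)
qed

text \<open>The exponent of the Laplace sign when the positions are deleted one after another. The
  summand at 0 is included; there the shifted index is the index itself.\<close>

definition shift_sum :: "(nat \<times> nat) list \<Rightarrow> nat" where
  "shift_sum ps = (\<Sum>t<length ps. shifted_index (map fst ps) t + shifted_index (map snd ps) t)"

text \<open>Laplace expansion along the unit rows. The induction runs from the end of the list: the
  row of the last position is made a unit row first, the induction hypothesis removes the earlier
  rows and columns, and then the last position is expanded at its shifted index.\<close>

lemma det_unit_rows:
  assumes "A \<in> carrier_mat n n" "distinct (map fst ps)" "distinct (map snd ps)"
    "set ps \<subseteq> {0..<n} \<times> {0..<n}"
  shows "det (unit_rows A (set ps)) =
    (-1) ^ shift_sum ps * det (delete_rows_cols A (set (map fst ps)) (set (map snd ps)))"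
  using assms
proof (induction ps arbitrary: A rule: rev_induct)
  case Nil
  then show ?case by (simp add: shift_sum_def)
next
  case (snoc x ps)
  obtain i j where x: "x = (i,j)" by (cases x)
  let ?I = "set (map fst ps)" and ?J = "set (map snd ps)"
  define A' where "A' = unit_rows A {x}"
  define i' where "i' = card {a \<in> - ?I. a < i}"
  define j' where "j' = card {a \<in> - ?J. a < j}"
  have A: "A \<in> carrier_mat n n" and A': "A' \<in> carrier_mat n n"
    using snoc.prems by (auto simp: A'_def)
  have I: "?I \<subseteq> {0..<n}" "i < n" "i \<notin> ?I" and J: "?J \<subseteq> {0..<n}" "j < n" "j \<notin> ?J"
    using snoc.prems by (auto simp: x)
  have inf: "infinite (- ?I)" "infinite (- ?J)"
    by (simp_all add: finite_compl)
  have card: "card ?I = length ps" "card ?J = length ps"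
    using snoc.prems distinct_card[of "map fst ps"] distinct_card[of "map snd ps"] by auto
  define m where "m = n - length ps"
  have M: "delete_rows_cols A' ?I ?J \<in> carrier_mat m m" (is "?M \<in> _")
    using delete_rows_cols_carrier[OF A' I(1) J(1)] card by (simp add: m_def)
  have i': "i' < m" and j': "j' < m"
    using card_Compl_less_lt[OF I] card_Compl_less_lt[OF J] card by (auto simp: i'_def j'_def m_def)
  \<comment> \<open>Row \<open>i\<close> and column \<open>j\<close> of the full matrix are row
    \<open>i'\<close> and column \<open>j'\<close> of the submatrix \<open>?M\<close>.\<close>
  have pick: "pick (- ?I) i' = i" "pick (- ?J) j' = j"
    using inf I J by (auto intro!: pick_eqI simp: i'_def j'_def)
  have row: "?M $$ (i', c) = (if c = j' then 1 else 0)" if c: "c < m" for c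
  proof -
    have "?M $$ (i', c) = A' $$ (i, pick (- ?J) c)" and "pick (- ?J) c < n"
      using delete_rows_cols_index[OF A' I(1) J(1), of i' c] i' c card pick by (auto simp: m_def)
    moreover have "pick (- ?J) c = j \<longleftrightarrow> c = j'"
      using pick_eq_iff_inf[OF inf(2)] pick by metis
    ultimately show ?thesis
      using A I by (auto simp: A'_def unit_rows_def x)
  qed
  have ins: "insert i ?I \<subseteq> {0..<n}" "insert j ?J \<subseteq> {0..<n}"
    using I J by auto
  \<comment> \<open>\<open>A\<close> and \<open>A'\<close> differ only in row \<open>i\<close>,
    which is deleted.\<close>
  have del: "delete_rows_cols A' (insert i ?I) (insert j ?J) = delete_rows_cols A (insert i ?I) (insert j ?J)"
  proof (rule eq_matI)
    note cA = delete_rows_cols_carrier[OF A ins]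
    fix a b assume "a < dim_row (delete_rows_cols A (insert i ?I) (insert j ?J))"
      "b < dim_col (delete_rows_cols A (insert i ?I) (insert j ?J))"
    then have ab: "a < n - card (insert i ?I)" "b < n - card (insert j ?J)"
      using cA by auto
    show "delete_rows_cols A' (insert i ?I) (insert j ?J) $$ (a,b) =
        delete_rows_cols A (insert i ?I) (insert j ?J) $$ (a,b)"
      using delete_rows_cols_index[OF A ins ab] delete_rows_cols_index(1)[OF A' ins ab] A
      by (auto simp: A'_def unit_rows_def x)
  qed (use delete_rows_cols_carrier[OF A ins] delete_rows_cols_carrier[OF A' ins] in auto)
  have "det ?M = (\<Sum>c<m. ?M $$ (i',c) * cofactor ?M i' c)"
    by (rule laplace_expansion_row[OF M i'])
  also have "\<dots> = (\<Sum>c<m. if c = j' then cofactor ?M i' c else 0)"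
    using row by (intro sum.cong) simp_all
  also have "\<dots> = (-1) ^ (i' + j') * det (delete_rows_cols A (insert i ?I) (insert j ?J))"
    using j' mat_delete_delete_rows_cols[OF A' I J] del by (simp add: cofactor_def i'_def j'_def)
  finally have detM: "det ?M = (-1) ^ (i' + j') * det (delete_rows_cols A (insert i ?I) (insert j ?J))" .
  have "unit_rows A (set (ps @ [x])) = unit_rows A' (set ps)"
    unfolding A'_def using I by (subst unit_rows_unit_rows) (auto simp: x)
  moreover have "det (unit_rows A' (set ps)) = (-1) ^ shift_sum ps * det ?M"
    using snoc.IH[OF A'] snoc.prems by simp
  moreover have "shift_sum (ps @ [x]) = shift_sum ps + (i' + j')"
  proof -
    have "distinct (map fst ps)" "distinct (map snd ps)"
      using snoc.prems by auto
    then have "shifted_index (map fst ps @ [i]) (length ps) = i'" "shifted_index (map snd ps @ [j]) (length ps) = j'"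
      using shifted_index_snoc[of "map fst ps" i] shifted_index_snoc[of "map snd ps" j]
      by (simp_all add: i'_def j'_def)
    then show ?thesis
      by (simp add: shift_sum_def x shifted_index_append)
  qed
  ultimately show ?case
    using detM by (simp add: x power_add)
qed

lemma sign_exponent_eq:
  assumes "length ps \<ge> 1"
  shows "sign_exponent \<mu> ps = shift_sum ps + num_right_bounded \<mu> ps"
proof -
  have "{..<length ps} = insert 0 {1..<length ps}"
    using assms by auto
  moreover have "ps \<noteq> []"
    using assms by auto
  ultimately show ?thesis
    by (simp add: sign_exponent_def shift_sum_def shifted_index_def nth_map)
qed

lemma num_right_bounded_eq:
  assumes "distinct ps"
  shows "num_right_bounded \<mu> ps = card {x \<in> set ps. right_bounded_entry (\<mu> $$ x)}"
proof -
  have "{x \<in> set ps. right_bounded_entry (\<mu> $$ x)} =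
      (\<lambda>t. ps ! t) ` {t. t < length ps \<and> right_bounded_entry (\<mu> $$ (ps ! t))}"
    unfolding set_conv_nth by fastforce
  moreover have "inj_on (\<lambda>t. ps ! t) {t. t < length ps \<and> right_bounded_entry (\<mu> $$ (ps ! t))}"
    using assms by (auto simp: inj_on_def nth_eq_iff_index_eq)
  ultimately show ?thesis
    by (simp add: num_right_bounded_def card_image)
qed

lemma diagonal_set_list:
  assumes "finite P" "inj_on fst P" "inj_on snd P"
  obtains ps where "set ps = P" "distinct (map fst ps)" "distinct (map snd ps)"
  using assms finite_distinct_list[of P] by (metis distinct_map)

section \<open>Nonsingularity of bounded interval matrices\<close>

text \<open>Induction on the number of rows with weight strictly between 0 and 1: by linearity in
  such a row the determinant is a convex combination of those with weight 0 and weight 1. The factor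
  \<open>\<kappa>\<close> carries the common sign.\<close>

lemma det_row_convex_pos:
  fixes L U :: "nat \<times> nat \<Rightarrow> real" and \<kappa> :: real and n :: nat
  defines "B \<equiv> \<lambda>d. mat n n (\<lambda>(i,j). (1 - d i) * L (i,j) + d i * U (i,j))"
  assumes vert: "\<And>d. (\<And>i. i < n \<Longrightarrow> d i \<in> {0,1}) \<Longrightarrow> \<kappa> * det (B d) > 0"
    and d: "\<And>i. i < n \<Longrightarrow> 0 \<le> d i \<and> d i \<le> (1::real)"
  shows "\<kappa> * det (B d) > 0"
  using d
proof (induction "card {i. i < n \<and> d i \<notin> {0,1}}" arbitrary: d rule: less_induct)
  case less
  show ?case
  proof (cases "\<forall>i<n. d i \<in> {0,1}")
    case True
    then show ?thesis using vert by blast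
  next
    case False
    then obtain r where r: "r < n" "d r \<notin> {0,1}" by auto
    have dr: "0 < d r" "d r < 1"
      using r less.prems[of r] by auto
    have smaller: "\<kappa> * det (B (d(r := v))) > 0" if v: "v \<in> {0,1}" for v
    proof (rule less.hyps)
      have "{i. i < n \<and> (d(r := v)) i \<notin> {0,1}} \<subset> {i. i < n \<and> d i \<notin> {0,1}}"
        using r v by auto
      then show "card {i. i < n \<and> (d(r := v)) i \<notin> {0,1}} < card {i. i < n \<and> d i \<notin> {0,1}}"
        by (intro psubset_card_mono) auto
    qed (use less.prems v in auto)
    have lin: "det (B d) = (1 - d r) * det (B (d(r := 0))) + d r * det (B (d(r := 1)))"
      using r by (intro det_row_linear[where n = n and r = r]) (auto simp: B_def)
    have "\<kappa> * det (B d) = (1 - d r) * (\<kappa> * det (B (d(r := 0)))) + d r * (\<kappa> * det (B (d(r := 1))))"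
      unfolding lin by (simp add: algebra_simps)
    also have "\<dots> > 0"
      by (rule add_pos_pos[OF mult_pos_pos[OF _ smaller] mult_pos_pos[OF dr(1) smaller]]) (use dr in auto)
    finally show ?thesis .
  qed
qed

text \<open>A kernel vector \<open>x\<close> of \<open>A\<close> would also be in the kernel of a
  matrix whose rows mix the minimising and the maximising row at \<open>x\<close>. The determinant
  of that matrix is a convex combination of vertex determinants, all nonzero with the sign of
  \<open>\<kappa>\<close>.\<close>

lemma interval_mat_nonsingular:
  fixes lo hi :: "nat \<times> nat \<Rightarrow> real" and \<kappa> :: real
  assumes A: "A \<in> carrier_mat n n"
    and box: "\<And>i j. \<lbrakk>i < n; j < n\<rbrakk> \<Longrightarrow> lo (i,j) \<le> A $$ (i,j) \<and> A $$ (i,j) \<le> hi (i,j)"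
    and vert: "\<And>y z :: nat \<Rightarrow> bool.
      \<kappa> * det (mat n n (\<lambda>(i,j). if y i = z j then hi (i,j) else lo (i,j))) > 0"
  shows "det A \<noteq> 0"
proof
  assume "det A = 0"
  then obtain x where x: "x \<in> carrier_vec n" "x \<noteq> 0\<^sub>v n" "A *\<^sub>v x = 0\<^sub>v n"
    using det_0_iff_vec_prod_zero_field[OF A] by blast
  \<comment> \<open>\<open>z\<close> records the signs of \<open>x\<close>; a zero component may
    count as either. With it, \<open>L\<close> minimises and \<open>U\<close> maximises the product
    of each row with \<open>x\<close>.\<close>
  define z where "z = (\<lambda>j. x $ j \<ge> 0)"
  define L where "L = (\<lambda>(i,j). if z j then lo (i,j) else hi (i,j))"
  define U where "U = (\<lambda>(i,j). if z j then hi (i,j) else lo (i,j))"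
  define f where "f = (\<lambda>i. \<Sum>j<n. L (i,j) * x $ j)"
  define g where "g = (\<lambda>i. \<Sum>j<n. U (i,j) * x $ j)"
  have Ax: "(\<Sum>j<n. A $$ (i,j) * x $ j) = 0" if "i < n" for i
  proof -
    have "0 = (A *\<^sub>v x) $ i"
      unfolding x(3) using that by simp
    also have "\<dots> = (\<Sum>j<n. A $$ (i,j) * x $ j)"
      using A x(1) that by (simp add: scalar_prod_def atLeast0LessThan)
    finally show ?thesis by simp
  qed
  have f: "f i \<le> 0" if "i < n" for i
  proof -
    have "f i \<le> (\<Sum>j<n. A $$ (i,j) * x $ j)"
      unfolding f_def using box[OF that]
      by (intro sum_mono) (auto simp: L_def z_def intro: mult_right_mono mult_right_mono_neg)
    then show ?thesis using Ax that by simp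
  qed
  have g: "g i \<ge> 0" if "i < n" for i
  proof -
    have "(\<Sum>j<n. A $$ (i,j) * x $ j) \<le> g i"
      unfolding g_def using box[OF that]
      by (intro sum_mono) (auto simp: U_def z_def intro: mult_right_mono mult_right_mono_neg)
    then show ?thesis using Ax that by simp
  qed
  \<comment> \<open>The weight at which the affine function from \<open>f i \<le> 0\<close> to
    \<open>g i \<ge> 0\<close> vanishes.\<close>
  have "\<exists>d. 0 \<le> d \<and> d \<le> 1 \<and> (1 - d) * f i + d * g i = 0" if "i < n" for i
  proof (cases "f i = 0")
    case False
    then have "f i < 0" "g i \<ge> 0" using f g that by force+
    then show ?thesis
      by (intro exI[of _ "f i / (f i - g i)"]) (auto simp: field_simps)
  qed (auto intro: exI[of _ 0])
  then obtain d where d: "\<And>i. i < n \<Longrightarrow> 0 \<le> d i \<and> d i \<le> 1 \<and> (1 - d i) * f i + d i * g i = 0"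
    by metis
  define B where "B = (\<lambda>d. mat n n (\<lambda>(i,j). (1 - d i) * L (i,j) + d i * U (i,j)))"
  have "B d *\<^sub>v x = 0\<^sub>v n"
  proof (rule eq_vecI)
    fix i assume "i < dim_vec (0\<^sub>v n :: real vec)"
    then have i: "i < n" by simp
    have "(B d *\<^sub>v x) $ i = (\<Sum>j<n. ((1 - d i) * L (i,j) + d i * U (i,j)) * x $ j)"
      using x i by (simp add: B_def scalar_prod_def atLeast0LessThan)
    also have "\<dots> = (1 - d i) * f i + d i * g i"
      unfolding f_def g_def sum_distrib_left sum.distrib[symmetric]
      by (rule sum.cong) (simp_all add: algebra_simps)
    also have "\<dots> = 0\<^sub>v n $ i"
      using d i by simp
    finally show "(B d *\<^sub>v x) $ i = 0\<^sub>v n $ i" .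
  qed (simp add: B_def)
  then have "det (B d) = 0"
    using x det_0_iff_vec_prod_zero_field[of "B d" n] by (auto simp: B_def)
  moreover have "\<kappa> * det (B d) > 0"
    unfolding B_def
  proof (rule det_row_convex_pos)
    fix e :: "nat \<Rightarrow> real" assume e: "\<And>i. i < n \<Longrightarrow> e i \<in> {0,1}"
    \<comment> \<open>With weights 0 and 1 each row comes from \<open>L\<close> or from
      \<open>U\<close>; either way \<open>hi\<close> stands exactly where the choice for the row
      agrees with \<open>z j\<close>.\<close>
    have "mat n n (\<lambda>(i,j). (1 - e i) * L (i,j) + e i * U (i,j)) =
        mat n n (\<lambda>(i,j). if (e i = 1) = z j then hi (i,j) else lo (i,j))"
    proof (rule eq_matI)
      fix i j assume "i < dim_row (mat n n (\<lambda>(i,j). if (e i = 1) = z j then hi (i,j) else lo (i,j)))"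
        "j < dim_col (mat n n (\<lambda>(i,j). if (e i = 1) = z j then hi (i,j) else lo (i,j)))"
      then show "mat n n (\<lambda>(i,j). (1 - e i) * L (i,j) + e i * U (i,j)) $$ (i,j) =
          mat n n (\<lambda>(i,j). if (e i = 1) = z j then hi (i,j) else lo (i,j)) $$ (i,j)"
        using e[of i] by (auto simp: L_def U_def)
    qed auto
    then show "\<kappa> * det (mat n n (\<lambda>(i,j). (1 - e i) * L (i,j) + e i * U (i,j))) > 0"
      using vert[of "\<lambda>i. e i = 1" z] by simp
  qed (use d in auto)
  ultimately show False by simp
qed

section \<open>Interval entries\<close>

text \<open>Otherwise a ball around the infimum misses \<open>S\<close>, although elements of
  \<open>S\<close> come arbitrarily close to it.\<close>

lemma closed_Inf_mem:
  fixes S :: "real set"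
  assumes "closed S" "S \<noteq> {}" "bdd_below S"
  shows "Inf S \<in> S"
proof (rule ccontr)
  assume "Inf S \<notin> S"
  then obtain e where e: "e > 0" "\<And>y. dist y (Inf S) < e \<Longrightarrow> y \<notin> S"
    using assms(1) unfolding closed_def open_dist by (metis Compl_iff)
  obtain x where x: "x \<in> S" "x < Inf S + e"
    using cInf_lessD[OF assms(2), of "Inf S + e"] e(1) by auto
  then have "dist x (Inf S) < e"
    using cInf_lower[OF x(1) assms(3)] by (simp add: dist_real_def)
  then show False
    using e(2) x(1) by blast
qed

lemma closed_Sup_mem:
  fixes S :: "real set"
  assumes "closed S" "S \<noteq> {}" "bdd_above S"
  shows "Sup S \<in> S"
proof (rule ccontr)
  assume "Sup S \<notin> S"
  then obtain e where e: "e > 0" "\<And>y. dist y (Sup S) < e \<Longrightarrow> y \<notin> S"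
    using assms(1) unfolding closed_def open_dist by (metis Compl_iff)
  obtain x where x: "x \<in> S" "Sup S - e < x"
    using less_cSupD[OF assms(2), of "Sup S - e"] e(1) by auto
  then have "dist x (Sup S) < e"
    using cSup_upper[OF x(1) assms(3)] by (simp add: dist_real_def)
  then show False
    using e(2) x(1) by blast
qed

text \<open>Boundedness below and above separates four cases; connectedness fills in everything
  between two elements, and closedness provides the finite endpoints.\<close>

lemma closed_interval_cases:
  fixes S :: "real set"
  assumes S: "closed S" "connected S" "S \<noteq> {}"
  shows "S = UNIV \<or> bounded_entry S \<or> left_bounded_entry S \<or> right_bounded_entry S"
proof -
  have mid: "z \<in> S" if "x \<in> S" "y \<in> S" "x \<le> z" "z \<le> y" for x y z
    using connectedD_interval[OF S(2)] that by blast
  have below: "\<exists>x\<in>S. x \<le> z" if "\<not> bdd_below S" for z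
    using that unfolding bdd_below_def by (meson linear)
  have above: "\<exists>x\<in>S. z \<le> x" if "\<not> bdd_above S" for z
    using that unfolding bdd_above_def by (meson linear)
  show ?thesis
  proof (cases "bdd_below S"; cases "bdd_above S")
    assume b: "bdd_below S" "bdd_above S"
    have "x \<in> S \<longleftrightarrow> x \<in> {Inf S..Sup S}" for x
      using cInf_lower[OF _ b(1), of x] cSup_upper[OF _ b(2), of x]
        mid[OF closed_Inf_mem[OF S(1,3) b(1)] closed_Sup_mem[OF S(1,3) b(2)], of x] by auto
    then have "S = {Inf S..Sup S}" by blast
    moreover have "Inf S \<le> Sup S"
      using cInf_le_cSup S(3) b by blast
    ultimately show ?thesis unfolding bounded_entry_def by blast
  next
    assume b: "bdd_below S" "\<not> bdd_above S"
    have "x \<in> S \<longleftrightarrow> x \<in> {Inf S..}" for x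
      using cInf_lower[OF _ b(1), of x] mid[OF closed_Inf_mem[OF S(1,3) b(1)], of _ x] above[OF b(2), of x]
      by auto
    then have "S = {Inf S..}" by blast
    then show ?thesis unfolding left_bounded_entry_def by blast
  next
    assume b: "\<not> bdd_below S" "bdd_above S"
    have "x \<in> S \<longleftrightarrow> x \<in> {..Sup S}" for x
      using cSup_upper[OF _ b(2), of x] mid[OF _ closed_Sup_mem[OF S(1,3) b(2)], of _ x] below[OF b(1), of x]
      by auto
    then have "S = {..Sup S}" by blast
    then show ?thesis unfolding right_bounded_entry_def by blast
  next
    assume b: "\<not> bdd_below S" "\<not> bdd_above S"
    have "S = UNIV"
    proof (rule UNIV_eq_I[symmetric])
      fix x
      show "x \<in> S"
        using mid below[OF b(1), of x] above[OF b(2), of x] by blast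
    qed
    then show ?thesis by blast
  qed
qed

lemma bounded_entry_bdd:
  assumes "bounded_entry S"
  shows "bdd_below S" "bdd_above S"
  using assms by (auto simp: bounded_entry_def)

lemma left_bounded_entry_bdd:
  assumes "left_bounded_entry S"
  shows "bdd_below S" "\<not> bdd_above S"
proof -
  obtain a where S: "S = {a..}"
    using assms by (auto simp: left_bounded_entry_def)
  then show "bdd_below S" by simp
  have "\<not> max a M + 1 \<le> M" for M :: real
    by simp
  moreover have "max a M + 1 \<in> S" for M
    by (simp add: S)
  ultimately show "\<not> bdd_above S"
    unfolding bdd_above_def by blast
qed

lemma right_bounded_entry_bdd:
  assumes "right_bounded_entry S"
  shows "\<not> bdd_below S" "bdd_above S"
proof -
  obtain a where S: "S = {..a}"
    using assms by (auto simp: right_bounded_entry_def)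
  then show "bdd_above S" by simp
  have "\<not> M \<le> min a M - 1" for M :: real
    by simp
  moreover have "min a M - 1 \<in> S" for M
    by (simp add: S)
  ultimately show "\<not> bdd_below S"
    unfolding bdd_below_def by blast
qed

lemma not_bdd_UNIV_real: "\<not> bdd_below (UNIV :: real set)" "\<not> bdd_above (UNIV :: real set)"
  by (auto simp: bdd_below_def bdd_above_def not_le intro: lt_ex gt_ex)

text \<open>The kinds differ in the sides on which they are bounded.\<close>

lemma entry_kinds_disjoint:
  shows "bounded_entry S \<Longrightarrow> \<not> half_bounded_entry S"
    and "left_bounded_entry S \<Longrightarrow> \<not> right_bounded_entry S"
    and "bounded_entry S \<Longrightarrow> S \<noteq> UNIV"
    and "half_bounded_entry S \<Longrightarrow> S \<noteq> UNIV"
  using bounded_entry_bdd[of S] left_bounded_entry_bdd[of S] right_bounded_entry_bdd[of S]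
    not_bdd_UNIV_real
  by (auto simp: half_bounded_entry_def)

section \<open>Constant sign of the determinant, and parity of vertex patterns\<close>

lemma det_same_sign:
  fixes F :: "nat \<times> nat \<Rightarrow> real set"
  assumes A: "A \<in> carrier_mat n n" and B: "B \<in> carrier_mat n n"
    and conn: "\<And>x. x \<in> {0..<n} \<times> {0..<n} \<Longrightarrow> connected (F x) \<and> A $$ x \<in> F x \<and> B $$ x \<in> F x"
    and nonsing: "\<And>M. \<lbrakk>M \<in> carrier_mat n n; \<And>x. x \<in> {0..<n} \<times> {0..<n} \<Longrightarrow> M $$ x \<in> F x\<rbrakk> \<Longrightarrow> det M \<noteq> 0"
  shows "det A * det B > 0"
proof -
  \<comment> \<open>The segment from \<open>A\<close> to \<open>B\<close> stays in the product of
    the connected sets \<open>F x\<close>; a change of sign along it would give a zero of the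
    determinant.\<close>
  define M where "M = (\<lambda>t. mat n n (\<lambda>x. (1 - t) * A $$ x + t * B $$ x))"
  have M01: "M 0 = A" "M 1 = B"
    using A B by (auto simp: M_def)
  \<comment> \<open>The Leibniz formula makes the determinant a polynomial in
    \<open>t\<close>.\<close>
  have "continuous_on {0..1} (\<lambda>t. \<Sum>q | q permutes {0..<n}.
      of_int (sign q) * (\<Prod>i = 0..<n. (1 - t) * A $$ (i, q i) + t * B $$ (i, q i)))"
    by (intro continuous_intros)
  also have "(\<lambda>t. \<Sum>q | q permutes {0..<n}.
      of_int (sign q) * (\<Prod>i = 0..<n. (1 - t) * A $$ (i, q i) + t * B $$ (i, q i))) = (\<lambda>t. det (M t))"
  proof
    fix t
    have "q i < n" if "q permutes {0..<n}" "i < n" for q i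
      using permutes_in_image[OF that(1), of i] that(2) by simp
    then show "(\<Sum>q | q permutes {0..<n}.
        of_int (sign q) * (\<Prod>i = 0..<n. (1 - t) * A $$ (i, q i) + t * B $$ (i, q i))) = det (M t)"
      by (subst det_def'[of _ n]) (auto simp: M_def intro!: sum.cong prod.cong)
  qed
  finally have cont: "continuous_on {0..1} (\<lambda>t. det (M t))" .
  have nz: "det (M t) \<noteq> 0" if t: "0 \<le> t" "t \<le> 1" for t
  proof (rule nonsing)
    fix x assume x: "x \<in> {0..<n} \<times> {0..<n}"
    have "M t $$ x = A $$ x + t * (B $$ x - A $$ x)"
      using x by (auto simp: M_def algebra_simps)
    moreover have "A $$ x + t * (B $$ x - A $$ x) \<in> F x"
    proof (cases "A $$ x \<le> B $$ x")
      case True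
      then have "0 \<le> t * (B $$ x - A $$ x)" "t * (B $$ x - A $$ x) \<le> 1 * (B $$ x - A $$ x)"
        using t mult_right_mono[OF t(2), of "B $$ x - A $$ x"] by auto
      then show ?thesis
        using connectedD_interval[of "F x" "A $$ x" "B $$ x"] conn[OF x] by auto
    next
      case False
      then have "t * (B $$ x - A $$ x) \<le> 0" "1 * (B $$ x - A $$ x) \<le> t * (B $$ x - A $$ x)"
        using t mult_right_mono_neg[OF t(2), of "B $$ x - A $$ x"]
        by (auto intro: mult_nonneg_nonpos)
      then show ?thesis
        using connectedD_interval[of "F x" "B $$ x" "A $$ x"] conn[OF x] by auto
    qed
    ultimately show "M t $$ x \<in> F x" by simp
  qed (simp add: M_def)
  have "\<not> (det A \<le> 0 \<and> 0 \<le> det B)" "\<not> (det B \<le> 0 \<and> 0 \<le> det A)"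
    using IVT'[of "\<lambda>t. det (M t)" 0 0 1] IVT2'[of "\<lambda>t. det (M t)" 1 0 0] cont nz M01 by auto
  then show ?thesis
    by (auto simp: zero_less_mult_iff)
qed

text \<open>In a 2 by 2 submatrix the minimum is taken where the exclusive or of \<open>y a\<close>
  and \<open>z b\<close> holds. Over the four corners each of the two row signs and two column signs
  occurs twice, so the number of minima is even.\<close>

lemma even_type_xor:
  assumes "\<And>i j. \<lbrakk>i < dim_row \<nu>; j < dim_col \<nu>; bounded_entry (\<nu> $$ (i,j)); \<not> constant_entry (\<nu> $$ (i,j))\<rbrakk>
    \<Longrightarrow> \<gamma> $$ (i,j) = {Inf (\<nu> $$ (i,j))} \<longleftrightarrow> y i \<noteq> (z j :: bool)"
  shows "even_type \<nu> \<gamma>"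
  unfolding even_type_def
proof (intro allI impI)
  fix i i' j j'
  assume *: "i < i' \<and> i' < dim_row \<nu> \<and> j < j' \<and> j' < dim_col \<nu> \<and>
    (\<forall>ab \<in> {i,i'} \<times> {j,j'}. bounded_entry (\<nu> $$ ab))"
  show "(\<exists>ab \<in> {i,i'} \<times> {j,j'}. constant_entry (\<nu> $$ ab)) \<or>
    even (card {ab \<in> {i,i'} \<times> {j,j'}. \<gamma> $$ ab = {Inf (\<nu> $$ ab)}})"
  proof (rule disjCI)
    assume "\<not> even (card {ab \<in> {i,i'} \<times> {j,j'}. \<gamma> $$ ab = {Inf (\<nu> $$ ab)}})"
    show "\<exists>ab \<in> {i,i'} \<times> {j,j'}. constant_entry (\<nu> $$ ab)"
    proof (rule ccontr)
      assume nc: "\<not> (\<exists>ab \<in> {i,i'} \<times> {j,j'}. constant_entry (\<nu> $$ ab))"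
      have "\<gamma> $$ (a,b) = {Inf (\<nu> $$ (a,b))} \<longleftrightarrow> y a \<noteq> z b" if "a \<in> {i,i'}" "b \<in> {j,j'}" for a b
      proof (rule assms)
        show "a < dim_row \<nu>" "b < dim_col \<nu>"
          using * that by auto
        show "bounded_entry (\<nu> $$ (a,b))" "\<not> constant_entry (\<nu> $$ (a,b))"
          using * nc that by blast+
      qed
      then have "{ab \<in> {i,i'} \<times> {j,j'}. \<gamma> $$ ab = {Inf (\<nu> $$ ab)}} =
          {ab \<in> {i,i'} \<times> {j,j'}. y (fst ab) \<noteq> z (snd ab)}"
        by (intro Collect_cong conj_cong refl) force
      moreover have "card {ab \<in> {i,i'} \<times> {j,j'}. y (fst ab) \<noteq> z (snd ab)} =
          (\<Sum>ab \<in> {i,i'} \<times> {j,j'}. if y (fst ab) \<noteq> z (snd ab) then 1 else 0)"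
        unfolding card_eq_sum by (rule sum.inter_filter) simp
      \<comment> \<open>\<open>i < i'\<close> and \<open>j < j'\<close> make the four positions
        distinct, so the count is a sum of four terms.\<close>
      moreover have "{i,i'} \<times> {j,j'} = {(i,j), (i,j'), (i',j), (i',j')}"
        by auto
      ultimately have "even (card {ab \<in> {i,i'} \<times> {j,j'}. \<gamma> $$ ab = {Inf (\<nu> $$ ab)}})"
        using * by simp
      then show False
        using \<open>\<not> even (card {ab \<in> {i,i'} \<times> {j,j'}. \<gamma> $$ ab = {Inf (\<nu> $$ ab)}})\<close> by blast
    qed
  qed
qed

section \<open>Coefficients of the determinant\<close>

text \<open>The base point of the expansion: the nonconstant entries are the variables, set to
  0.\<close>

definition const_mat :: "real set mat \<Rightarrow> real mat" where
  "const_mat = map_mat (\<lambda>S. if constant_entry S then the_elem S else 0)"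

definition nonconst_positions :: "real set mat \<Rightarrow> (nat \<times> nat) set" where
  "nonconst_positions \<nu> = {x \<in> {0..<dim_row \<nu>} \<times> {0..<dim_col \<nu>}. \<not> constant_entry (\<nu> $$ x)}"

lemma const_mat_carrier [simp]: "const_mat \<nu> \<in> carrier_mat n m \<longleftrightarrow> \<nu> \<in> carrier_mat n m"
  unfolding carrier_mat_def const_mat_def by simp

lemma delete_rows_cols_map:
  assumes "A \<in> carrier_mat n m" "I \<subseteq> {0..<n}" "J \<subseteq> {0..<m}"
  shows "delete_rows_cols (map_mat f A) I J = map_mat f (delete_rows_cols A I J)"
proof (rule eq_matI)
  have fA: "map_mat f A \<in> carrier_mat n m"
    using assms(1) by simp
  note car = delete_rows_cols_carrier[OF assms] delete_rows_cols_carrier[OF fA assms(2,3)]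
  show "dim_row (delete_rows_cols (map_mat f A) I J) = dim_row (map_mat f (delete_rows_cols A I J))"
    "dim_col (delete_rows_cols (map_mat f A) I J) = dim_col (map_mat f (delete_rows_cols A I J))"
    using car by auto
  fix i j assume "i < dim_row (map_mat f (delete_rows_cols A I J))" "j < dim_col (map_mat f (delete_rows_cols A I J))"
  then have ij: "i < n - card I" "j < m - card J"
    using car by auto
  show "delete_rows_cols (map_mat f A) I J $$ (i,j) = map_mat f (delete_rows_cols A I J) $$ (i,j)"
    using delete_rows_cols_index[OF assms ij] delete_rows_cols_index(1)[OF fA assms(2,3) ij] ij car assms(1)
    by simp
qed

text \<open>A permutation that meets a nonconstant entry contributes a product with a factor 0, so
  the Leibniz formula loses exactly the terms that \<open>detc\<close> omits.\<close>

lemma detc_eq_det_const_mat: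
  assumes "\<nu> \<in> carrier_mat n n"
  shows "detc \<nu> = det (const_mat \<nu>)"
proof -
  let ?C = "const_mat \<nu>"
  have lt: "q i < n" if "q permutes {0..<n}" "i < n" for q i
    using permutes_in_image[OF that(1), of i] that(2) by simp
  have "det ?C = (\<Sum>q | q permutes {0..<n}. of_int (sign q) * (\<Prod>i = 0..<n. ?C $$ (i, q i)))"
    using assms by (intro det_def') simp
  also have "\<dots> = (\<Sum>q | q permutes {0..<n} \<and> (\<forall>i<n. constant_entry (\<nu> $$ (i, q i))).
      of_int (sign q) * (\<Prod>i = 0..<n. ?C $$ (i, q i)))"
  proof (rule sum.mono_neutral_right)
    show "\<forall>q \<in> {q. q permutes {0..<n}} - {q. q permutes {0..<n} \<and> (\<forall>i<n. constant_entry (\<nu> $$ (i, q i)))}.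
        of_int (sign q) * (\<Prod>i = 0..<n. ?C $$ (i, q i)) = 0"
    proof
      fix q assume "q \<in> {q. q permutes {0..<n}} - {q. q permutes {0..<n} \<and> (\<forall>i<n. constant_entry (\<nu> $$ (i, q i)))}"
      then obtain i where "q permutes {0..<n}" "i < n" "\<not> constant_entry (\<nu> $$ (i, q i))"
        by auto
      then have "i \<in> {0..<n}" "?C $$ (i, q i) = 0"
        using assms lt by (auto simp: const_mat_def)
      then have "(\<Prod>i = 0..<n. ?C $$ (i, q i)) = 0"
        by (intro prod_zero) auto
      then show "of_int (sign q) * (\<Prod>i = 0..<n. ?C $$ (i, q i)) = 0"
        by simp
    qed
  qed (auto simp: finite_permutations)
  also have "\<dots> = detc \<nu>"
    using assms lt unfolding detc_def
    by (intro sum.cong arg_cong2[where f = "(*)"] prod.cong) (auto simp: const_mat_def)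
  finally show ?thesis by simp
qed

text \<open>\<open>const_mat\<close> commutes with deleting rows and columns. So, up to sign, the
  coefficient of the monomial on the positions \<open>ps\<close> is the \<open>detc\<close> of the
  complementary matrix.\<close>

lemma detc_complementary_mat:
  assumes "\<nu> \<in> carrier_mat n n" "pg_diagonal \<nu> ps"
  shows "det (unit_rows (const_mat \<nu>) (set ps)) = (-1) ^ shift_sum ps * detc (complementary_mat \<nu> ps)"
proof -
  have ps: "distinct (map fst ps)" "distinct (map snd ps)" "set ps \<subseteq> {0..<n} \<times> {0..<n}"
    using assms by (auto simp: pg_diagonal_def)
  have sub: "set (map fst ps) \<subseteq> {0..<n}" "set (map snd ps) \<subseteq> {0..<n}"
    using ps(3) by auto
  have "delete_rows_cols (const_mat \<nu>) (set (map fst ps)) (set (map snd ps)) =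
      const_mat (complementary_mat \<nu> ps)"
    unfolding const_mat_def complementary_mat_def by (rule delete_rows_cols_map[OF assms(1) sub])
  moreover have "complementary_mat \<nu> ps \<in> carrier_mat (n - length ps) (n - length ps)"
    using delete_rows_cols_carrier[OF assms(1) sub] distinct_card[OF ps(1)] distinct_card[OF ps(2)]
    by (simp add: complementary_mat_def)
  ultimately show ?thesis
    using det_unit_rows[of "const_mat \<nu>" n ps] ps assms(1) by (simp add: detc_eq_det_const_mat)
qed

text \<open>Both clauses together say that all coefficients vanish: the complementary matrix of a
  full-length diagonal is 0 by 0 with \<open>detc\<close> equal to 1, so vanishing there means that
  no such diagonal exists. Sets with a repeated column have coefficient 0 anyway.\<close>

lemma no_nonzero_coefficient_iff:
  assumes \<nu>: "\<nu> \<in> carrier_mat n n"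
  shows "(\<nexists>ps. pg_diagonal \<nu> ps \<and> totally_nonconstant \<nu> ps \<and> length ps = n) \<and>
      (\<forall>ps. pg_diagonal \<nu> ps \<and> totally_nonconstant \<nu> ps \<and> length ps < n \<longrightarrow>
        detc (complementary_mat \<nu> ps) = 0) \<longleftrightarrow>
    (\<forall>P \<subseteq> nonconst_positions \<nu>. inj_on fst P \<longrightarrow> det (unit_rows (const_mat \<nu>) P) = 0)"
    (is "?L \<longleftrightarrow> ?R")
proof
  assume L: ?L
  show ?R
  proof (intro allI impI)
    fix P assume P: "P \<subseteq> nonconst_positions \<nu>" "inj_on fst P"
    have range: "P \<subseteq> {0..<n} \<times> {0..<n}"
      using P(1) \<nu> by (auto simp: nonconst_positions_def)
    show "det (unit_rows (const_mat \<nu>) P) = 0"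
    proof (cases "inj_on snd P")
      case True
      have "finite P"
        using range finite_subset by blast
      then obtain ps where ps: "set ps = P" "distinct (map fst ps)" "distinct (map snd ps)"
        using diagonal_set_list P(2) True by blast
      have pg: "pg_diagonal \<nu> ps" "totally_nonconstant \<nu> ps"
        using ps P(1) by (auto simp: pg_diagonal_def totally_nonconstant_def nonconst_positions_def)
      have "set (map fst ps) \<subseteq> {0..<n}"
        using range ps(1) by auto
      then have "length ps \<le> n"
        using distinct_card[OF ps(2)] card_mono[of "{0..<n}" "set (map fst ps)"] by simp
      then have "detc (complementary_mat \<nu> ps) = 0"
        using L pg by (metis le_neq_implies_less)
      then show ?thesis
        using detc_complementary_mat[OF \<nu> pg(1)] ps(1) by simp
    qed (use \<nu> P range in \<open>auto intro: det_unit_rows_same_col\<close>)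
  qed
next
  assume R: ?R
  have zero: "detc (complementary_mat \<nu> ps) = 0" if "pg_diagonal \<nu> ps" "totally_nonconstant \<nu> ps" for ps
  proof -
    have "set ps \<subseteq> nonconst_positions \<nu>"
      using that by (auto simp: pg_diagonal_def totally_nonconstant_def nonconst_positions_def)
    moreover have "inj_on fst (set ps)"
      using that(1) by (simp add: pg_diagonal_def distinct_map)
    ultimately show ?thesis
      using R detc_complementary_mat[OF \<nu> that(1)] by auto
  qed
  have "False" if ps: "pg_diagonal \<nu> ps" "totally_nonconstant \<nu> ps" "length ps = n" for ps
  proof -
    have "set (map fst ps) \<subseteq> {0..<n}" "set (map snd ps) \<subseteq> {0..<n}"
      "card (set (map fst ps)) = n" "card (set (map snd ps)) = n"
      using ps \<nu> distinct_card[of "map fst ps"] distinct_card[of "map snd ps"]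
      by (auto simp: pg_diagonal_def)
    then have c: "complementary_mat \<nu> ps \<in> carrier_mat 0 0"
      using delete_rows_cols_carrier[OF \<nu>] unfolding complementary_mat_def by (metis diff_self_eq_0)
    then have "const_mat (complementary_mat \<nu> ps) \<in> carrier_mat 0 0"
      by simp
    then have "detc (complementary_mat \<nu> ps) = 1"
      using detc_eq_det_const_mat[OF c] det_dim_zero by metis
    then show False
      using zero ps by simp
  qed
  then show ?L
    using zero by blast
qed

text \<open>A polynomial that is affine in each variable and vanishes on a product of sets with at
  least two elements vanishes identically, hence has zero coefficients. The converse is the
  expansion at \<open>const_mat \<nu>\<close>.\<close>

lemma det_zero_iff_no_nonzero_coefficient:
  assumes \<nu>: "\<nu> \<in> carrier_mat n n" and ne: "\<And>x. x \<in> {0..<n} \<times> {0..<n} \<Longrightarrow> \<nu> $$ x \<noteq> {}"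
  shows "(\<forall>A. contained_in_mat A \<nu> \<longrightarrow> det A = 0) \<longleftrightarrow>
    (\<forall>P \<subseteq> nonconst_positions \<nu>. inj_on fst P \<longrightarrow> det (unit_rows (const_mat \<nu>) P) = 0)"
    (is "?L \<longleftrightarrow> ?R")
proof
  define N where "N = nonconst_positions \<nu>"
  have N: "x \<in> N \<longleftrightarrow> x \<in> {0..<n} \<times> {0..<n} \<and> \<not> constant_entry (\<nu> $$ x)" for x
    using \<nu> by (auto simp: N_def nonconst_positions_def)
  \<comment> \<open>Right at the constant positions, arbitrary at the others: the vanishing is
    extended to all these matrices.\<close>
  define agree where "agree = (\<lambda>A. A \<in> carrier_mat n n \<and> (\<forall>x \<in> {0..<n} \<times> {0..<n} - N. A $$ x \<in> \<nu> $$ x))"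
  have upd: "agree (upd_mat A x v)" if "agree A" "x \<in> N" for A x v
    using that by (auto simp: agree_def upd_mat_def)
  assume L: ?L
  \<comment> \<open>Induction on the number of entries outside their sets: the determinant, affine
    in such an entry, vanishes at two points \<open>v\<close> and \<open>w\<close> of its set, hence
    everywhere.\<close>
  have det0: "det A = 0" if "agree A" for A
    using that
  proof (induction "card {x \<in> {0..<n} \<times> {0..<n}. A $$ x \<notin> \<nu> $$ x}" arbitrary: A rule: less_induct)
    case less
    have A: "A \<in> carrier_mat n n"
      using less.prems by (simp add: agree_def)
    show ?case
    proof (cases "contained_in_mat A \<nu>")
      case True
      then show ?thesis using L by blast
    next
      case False
      then obtain x where x: "x \<in> {0..<n} \<times> {0..<n}" "A $$ x \<notin> \<nu> $$ x"
        using A \<nu> by (auto simp: contained_in_mat_def)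
      then have xN: "x \<in> N"
        using less.prems by (auto simp: agree_def)
      obtain v where v: "v \<in> \<nu> $$ x"
        using ne[OF x(1)] by blast
      have "\<nu> $$ x \<noteq> {v}"
        using xN N by (auto simp: constant_entry_def)
      then obtain w where w: "w \<in> \<nu> $$ x" "w \<noteq> v"
        using v by blast
      have "det (upd_mat A x u) = 0" if u: "u \<in> \<nu> $$ x" for u
      proof (rule less.hyps)
        have "upd_mat A x u $$ y = (if y = x then u else A $$ y)" if "y \<in> {0..<n} \<times> {0..<n}" for y
          using that A by (auto simp: upd_mat_def)
        then have "{y \<in> {0..<n} \<times> {0..<n}. upd_mat A x u $$ y \<notin> \<nu> $$ y} =
            {y \<in> {0..<n} \<times> {0..<n}. A $$ y \<notin> \<nu> $$ y} - {x}"
          using u by (auto split: if_splits)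
        also have "\<dots> \<subset> {y \<in> {0..<n} \<times> {0..<n}. A $$ y \<notin> \<nu> $$ y}"
          using x by blast
        finally have "{y \<in> {0..<n} \<times> {0..<n}. upd_mat A x u $$ y \<notin> \<nu> $$ y} \<subset>
            {y \<in> {0..<n} \<times> {0..<n}. A $$ y \<notin> \<nu> $$ y}" .
        then show "card {y \<in> {0..<n} \<times> {0..<n}. upd_mat A x u $$ y \<notin> \<nu> $$ y} <
            card {y \<in> {0..<n} \<times> {0..<n}. A $$ y \<notin> \<nu> $$ y}"
          by (intro psubset_card_mono) auto
      qed (use upd less.prems xN in blast)
      then have e: "det A + (v - A $$ x) * det (unit_rows A {x}) = 0"
        "det A + (w - A $$ x) * det (unit_rows A {x}) = 0"
        using det_upd_mat[OF A x(1)] v w(1) by metis+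
      have "(w - v) * det (unit_rows A {x}) =
          (det A + (w - A $$ x) * det (unit_rows A {x})) - (det A + (v - A $$ x) * det (unit_rows A {x}))"
        by (simp add: algebra_simps)
      also have "\<dots> = 0"
        unfolding e by simp
      finally have "(w - v) * det (unit_rows A {x}) = 0" .
      then show ?thesis
        using e w(2) by simp
    qed
  qed
  \<comment> \<open>The coefficients follow by differentiating in one position after the other; each
    slope is obtained as the difference for a step of 1 in the entry.\<close>
  have unit0: "det (unit_rows A P) = 0" if "finite P" "P \<subseteq> N" "inj_on fst P" "agree A" for A P
    using that
  proof (induction P arbitrary: A rule: finite_induct)
    case empty
    then show ?case using det0 by simp
  next
    case (insert x P)
    have A: "A \<in> carrier_mat n n"
      using insert.prems by (simp add: agree_def)
    have x: "x \<in> N" "fst x \<notin> fst ` P"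
      using insert by auto
    let ?M = "unit_rows A P"
    have IH: "det (unit_rows A' P) = 0" if "agree A'" for A'
      using insert that by (auto simp: inj_on_insert)
    have "unit_rows ?M {x} = unit_rows A (insert x P)"
      using x by (subst unit_rows_unit_rows) auto
    moreover have "det (upd_mat ?M x (?M $$ x + 1)) = det ?M + (?M $$ x + 1 - ?M $$ x) * det (unit_rows ?M {x})"
      using A x N by (intro det_upd_mat) auto
    moreover have "det (upd_mat ?M x (?M $$ x + 1)) = 0"
      unfolding unit_rows_upd_mat[OF x(2), symmetric] using IH upd x insert.prems by blast
    ultimately show ?case
      using IH insert.prems by simp
  qed
  have "agree (const_mat \<nu>)"
    using \<nu> N by (auto simp: agree_def const_mat_def constant_entry_def)
  moreover have "finite N"
    using \<nu> by (simp add: N_def nonconst_positions_def)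
  ultimately show ?R
    using unit0 finite_subset unfolding N_def by blast
next
  assume R: ?R
  show ?L
  proof (intro allI impI)
    fix A assume A: "contained_in_mat A \<nu>"
    define N where "N = nonconst_positions \<nu>"
    have sub: "N \<subseteq> {0..<n} \<times> {0..<n}"
      using \<nu> by (auto simp: N_def nonconst_positions_def)
    have "A = add_on (const_mat \<nu>) (\<lambda>x. A $$ x) N"
    proof (rule eq_matI)
      fix i j assume "i < dim_row (add_on (const_mat \<nu>) (\<lambda>x. A $$ x) N)"
        "j < dim_col (add_on (const_mat \<nu>) (\<lambda>x. A $$ x) N)"
      then have ij: "i < n" "j < n"
        using \<nu> by (auto simp: add_on_def const_mat_def)
      then have "A $$ (i,j) \<in> \<nu> $$ (i,j)"
        using A \<nu> by (auto simp: contained_in_mat_def)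
      then show "A $$ (i,j) = add_on (const_mat \<nu>) (\<lambda>x. A $$ x) N $$ (i,j)"
        using ij \<nu> by (auto simp: add_on_def const_mat_def N_def nonconst_positions_def constant_entry_def)
    qed (use A in \<open>auto simp: add_on_def const_mat_def contained_in_mat_def\<close>)
    moreover have "det (add_on (const_mat \<nu>) (\<lambda>x. A $$ x) N) =
        (\<Sum>P | P \<subseteq> N \<and> inj_on fst P. prod (\<lambda>x. A $$ x) P * det (unit_rows (const_mat \<nu>) P))"
      using \<nu> sub finite_subset[OF sub] by (intro det_add_on[where n = n]) auto
    moreover have "\<dots> = 0"
      using R by (intro sum.neutral) (simp add: N_def)
    ultimately show "det A = 0" by simp
  qed
qed

section \<open>Nonnegative parameters and the signs of coefficients\<close>

lemma affine_nonneg_imp_slope_nonneg: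
  fixes q r :: real
  assumes "\<And>t. t \<ge> 0 \<Longrightarrow> q + t * r \<ge> 0"
  shows "r \<ge> 0"
proof (rule ccontr)
  assume "\<not> r \<ge> 0"
  then have r: "r < 0" by simp
  \<comment> \<open>For negative \<open>r\<close> this parameter makes \<open>t * r\<close> equal to
    \<open>- (\<bar>q\<bar> + 1)\<close>, which outweighs \<open>q\<close>.\<close>
  have "0 \<le> (\<bar>q\<bar> + 1) / (- r)"
    using r by (intro divide_nonneg_pos) auto
  then have "q + (\<bar>q\<bar> + 1) / (- r) * r \<ge> 0"
    by (rule assms)
  moreover have "(\<bar>q\<bar> + 1) / (- r) * r = - (\<bar>q\<bar> + 1)"
    using r by simp
  ultimately show False by linarith
qed

text \<open>A nonnegative affine function on a half-line has nonnegative slope; this is applied to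
  the parameters at \<open>P\<close> one after the other. The induction treats all
  \<open>T \<ge> 0\<close>, since the next slope needs the claim on a whole half-line; finally
  \<open>T = 0\<close> gives the coefficient at \<open>G\<close>.\<close>

lemma cone_coefficient_nonneg:
  fixes s :: "nat \<times> nat \<Rightarrow> real" and \<kappa> :: real
  assumes G: "G \<in> carrier_mat n n" and H: "H \<subseteq> {0..<n} \<times> {0..<n}"
    and cone: "\<And>T. (\<And>x. T x \<ge> 0) \<Longrightarrow> \<kappa> * det (add_on G (\<lambda>x. s x * T x) H) \<ge> 0"
    and P: "P \<subseteq> H" "inj_on fst P"
  shows "\<kappa> * prod s P * det (unit_rows G P) \<ge> 0"
proof -
  have "\<kappa> * prod s P * det (unit_rows (add_on G (\<lambda>x. s x * T x) H) P) \<ge> 0"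
    if "finite P" "P \<subseteq> H" "inj_on fst P" "\<And>x. T x \<ge> 0" for P T
    using that
  proof (induction P arbitrary: T rule: finite_induct)
    case empty
    then show ?case using cone by simp
  next
    case (insert x P)
    have x: "x \<in> H" "fst x \<notin> fst ` P"
      using insert by auto
    let ?A = "\<lambda>T. add_on G (\<lambda>x. s x * T x) H"
    let ?M = "unit_rows (?A T) P"
    have "\<kappa> * prod s P * det ?M + t * (\<kappa> * prod s P * s x * det (unit_rows ?M {x})) \<ge> 0" if t: "t \<ge> 0" for t
    proof -
      \<comment> \<open>The row of \<open>x\<close> does not occur in \<open>P\<close>, so
        \<open>?M\<close> and \<open>?A T\<close> agree at \<open>x\<close>; adding
        \<open>s x * t\<close> there raises the parameter \<open>T x\<close> by
        \<open>t\<close>.\<close>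
      have "upd_mat (?A T) x (?M $$ x + s x * t) = ?A (T(x := T x + t))"
        using x H G by (intro eq_matI) (auto simp: upd_mat_def add_on_def unit_rows_def algebra_simps)
      then have "upd_mat ?M x (?M $$ x + s x * t) = unit_rows (?A (T(x := T x + t))) P"
        using unit_rows_upd_mat[OF x(2)] by metis
      moreover have "det (upd_mat ?M x (?M $$ x + s x * t)) =
          det ?M + (?M $$ x + s x * t - ?M $$ x) * det (unit_rows ?M {x})"
        using G x H by (intro det_upd_mat) auto
      ultimately have "det (unit_rows (?A (T(x := T x + t))) P) = det ?M + s x * t * det (unit_rows ?M {x})"
        by simp
      moreover have "\<kappa> * prod s P * det (unit_rows (?A (T(x := T x + t))) P) \<ge> 0"
        using insert t by (intro insert.IH) (auto simp: inj_on_insert)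
      ultimately show ?thesis
        by (simp add: algebra_simps)
    qed
    then have "\<kappa> * prod s P * s x * det (unit_rows ?M {x}) \<ge> 0"
      by (rule affine_nonneg_imp_slope_nonneg)
    moreover have "unit_rows ?M {x} = unit_rows (?A T) (insert x P)"
      using x by (subst unit_rows_unit_rows) auto
    ultimately show ?case
      using insert.hyps by (simp add: mult_ac)
  qed
  from this[of P "\<lambda>_. 0"] have "\<kappa> * prod s P * det (unit_rows (add_on G (\<lambda>x. s x * 0) H) P) \<ge> 0"
    using P H finite_subset by (metis finite_SigmaI finite_atLeastLessThan order_refl)
  moreover have "add_on G (\<lambda>x. s x * 0) H = G"
    by (intro eq_matI) (auto simp: add_on_def)
  ultimately show ?thesis by simp
qed

lemma delete_rows_cols_contained:
  assumes \<mu>: "\<mu> \<in> carrier_mat n m" and I: "I \<subseteq> {0..<n}" and J: "J \<subseteq> {0..<m}"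
    and A: "contained_in_mat A \<mu>"
  shows "contained_in_mat (delete_rows_cols A I J) (delete_rows_cols \<mu> I J)"
proof -
  have A': "A \<in> carrier_mat n m"
    using A \<mu> by (auto simp: contained_in_mat_def)
  show ?thesis
    using delete_rows_cols_carrier[OF \<mu> I J] delete_rows_cols_carrier[OF A' I J]
      delete_rows_cols_index[OF \<mu> I J] delete_rows_cols_index(1)[OF A' I J] A \<mu>
    by (auto simp: contained_in_mat_def)
qed

text \<open>The deleted positions are filled with arbitrary elements of their entries. This realises
  a given matrix in the submatrix as a minor of a matrix contained in \<open>\<mu>\<close>.\<close>

lemma delete_rows_cols_contained_extend:
  assumes \<mu>: "\<mu> \<in> carrier_mat n m" and I: "I \<subseteq> {0..<n}" and J: "J \<subseteq> {0..<m}"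
    and ne: "\<And>x. x \<in> {0..<n} \<times> {0..<m} \<Longrightarrow> \<mu> $$ x \<noteq> {}"
    and B: "contained_in_mat B (delete_rows_cols \<mu> I J)"
  obtains A where "contained_in_mat A \<mu>" "delete_rows_cols A I J = B"
proof -
  \<comment> \<open>The inverse of \<open>pick (- I)\<close>: the index of a surviving row after the
    deletion.\<close>
  define pos where "pos = (\<lambda>(I :: nat set) r. card {a \<in> - I. a < r})"
  define A where "A = mat n m (\<lambda>(r,c). if r \<in> I \<or> c \<in> J then SOME v. v \<in> \<mu> $$ (r,c) else B $$ (pos I r, pos J c))"
  have "finite I" "finite J"
    using I J finite_subset by blast+
  then have inf: "infinite (- I)" "infinite (- J)"
    by (simp_all add: finite_compl)
  have A: "A \<in> carrier_mat n m"
    by (simp add: A_def)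
  have pick_pos: "pick (- I) (pos I r) = r" if "r \<notin> I" for r
    using pick_eqI[OF inf(1)] that by (simp add: pos_def)
  have pick_pos': "pick (- J) (pos J r) = r" if "r \<notin> J" for r
    using pick_eqI[OF inf(2)] that by (simp add: pos_def)
  have pos_pick: "pos I (pick (- I) k) = k" "pos J (pick (- J) k) = k" for k
    unfolding pos_def using inf card_pick_inf by blast+
  note c\<mu> = delete_rows_cols_carrier[OF \<mu> I J]
  have cB: "B \<in> carrier_mat (n - card I) (m - card J)"
    using B c\<mu> by (auto simp: contained_in_mat_def)
  have "A $$ (r,c) \<in> \<mu> $$ (r,c)" if rc: "r < n" "c < m" for r c
  proof (cases "r \<in> I \<or> c \<in> J")
    case True
    have "(SOME v. v \<in> \<mu> $$ (r,c)) \<in> \<mu> $$ (r,c)"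
      using ne[of "(r,c)"] rc by (intro some_in_eq[THEN iffD2]) auto
    then show ?thesis
      using rc True by (simp add: A_def)
  next
    case False
    then have lt: "pos I r < n - card I" "pos J c < m - card J"
      using card_Compl_less_lt[OF I rc(1)] card_Compl_less_lt[OF J rc(2)] by (auto simp: pos_def)
    then have "B $$ (pos I r, pos J c) \<in> delete_rows_cols \<mu> I J $$ (pos I r, pos J c)"
      using B c\<mu> by (auto simp: contained_in_mat_def)
    then show ?thesis
      using delete_rows_cols_index(1)[OF \<mu> I J lt] pick_pos pick_pos' False rc by (simp add: A_def)
  qed
  then have cont: "contained_in_mat A \<mu>"
    using A \<mu> by (auto simp: contained_in_mat_def)
  have "delete_rows_cols A I J = B"
  proof (rule eq_matI)
    fix i j assume "i < dim_row B" "j < dim_col B"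
    then have ij: "i < n - card I" "j < m - card J"
      using cB by auto
    show "delete_rows_cols A I J $$ (i,j) = B $$ (i,j)"
      using delete_rows_cols_index[OF A I J ij] by (simp add: A_def pos_pick)
  qed (use delete_rows_cols_carrier[OF A I J] cB in auto)
  then show ?thesis
    using that cont by blast
qed

section \<open>Square general closed interval matrices\<close>

text \<open>Meaningful for half-bounded entries only.\<close>

definition endpoint :: "real set \<Rightarrow> real" where
  "endpoint S = (if left_bounded_entry S then Inf S else Sup S)"

text \<open>A half-bounded entry consists of the numbers \<open>endpoint S + direction S * t\<close>
  with \<open>t \<ge> 0\<close>.\<close>

definition direction :: "real set \<Rightarrow> real" where
  "direction S = (if right_bounded_entry S then - 1 else 1)"

lemma half_bounded_ray:
  assumes "half_bounded_entry S"
  shows "v \<in> S \<longleftrightarrow> direction S * (v - endpoint S) \<ge> 0"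
proof (cases "left_bounded_entry S")
  case True
  then obtain a where "S = {a..}"
    by (auto simp: left_bounded_entry_def)
  moreover have "\<not> right_bounded_entry S"
    using True entry_kinds_disjoint by blast
  ultimately show ?thesis
    using True by (simp add: direction_def endpoint_def)
next
  case False
  then have "right_bounded_entry S"
    using assms by (simp add: half_bounded_entry_def)
  moreover from this obtain a where "S = {..a}"
    by (auto simp: right_bounded_entry_def)
  ultimately show ?thesis
    using False by (simp add: direction_def endpoint_def)
qed

lemma direction_square [simp]: "direction S * (direction S * t) = t"
  by (simp add: direction_def)

lemma bounded_entry_singleton: "bounded_entry {a}"
  unfolding bounded_entry_def by (rule exI[of _ a], rule exI[of _ a]) simp

lemma bounded_entry_endpoints:
  assumes "bounded_entry S"
  shows "S = {Inf S..Sup S}" "Inf S \<le> Sup S"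
  using assms by (auto simp: bounded_entry_def)

lemma vertex_matD:
  assumes "vertex_mat \<nu> \<gamma>" "i < dim_row \<nu>" "j < dim_col \<nu>"
  shows "bounded_entry (\<nu> $$ (i,j)) \<Longrightarrow>
      \<exists>v \<in> \<nu> $$ (i,j). \<gamma> $$ (i,j) = {v}"
    and "\<not> bounded_entry (\<nu> $$ (i,j)) \<Longrightarrow> \<gamma> $$ (i,j) = \<nu> $$ (i,j)"
proof -
  assume "bounded_entry (\<nu> $$ (i,j))"
  then obtain m M where mM: "m \<le> M" "\<nu> $$ (i,j) = {m..M}"
    by (auto simp: bounded_entry_def)
  then have "\<gamma> $$ (i,j) \<in> {{m}, {M}}"
    using assms unfolding vertex_mat_def by blast
  then show "\<exists>v \<in> \<nu> $$ (i,j). \<gamma> $$ (i,j) = {v}"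
    using mM by auto
qed (use assms in \<open>auto simp: vertex_mat_def\<close>)

locale square_interval_mat =
  fixes \<mu> :: "real set mat" and p :: nat
  assumes carrier: "\<mu> \<in> carrier_mat p p"
    and interval: "general_closed_interval_mat \<mu>"
begin

definition "H = {x \<in> {0..<p} \<times> {0..<p}. half_bounded_entry (\<mu> $$ x)}"

abbreviation "\<tau> \<equiv> tilde_mat \<mu>"
abbreviation "\<beta> \<equiv> bar_mat (tilde_mat \<mu>)"
abbreviation "lower_vertex \<equiv> real_mat (lower_mat (bar_mat (tilde_mat \<mu>)))"

lemma H_subset: "H \<subseteq> {0..<p} \<times> {0..<p}"
  by (auto simp: H_def)

lemma finite_H: "finite H"
  using H_subset finite_subset by blast

lemma dims: "dim_row \<mu> = p" "dim_col \<mu> = p" "dim_row \<tau> = p" "dim_col \<tau> = p" "dim_row \<beta> = p" "dim_col \<beta> = p"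
  using carrier by (auto simp: tilde_mat_def bar_mat_def)

lemma contained_iff:
  "contained_in_mat A \<mu> \<longleftrightarrow> A \<in> carrier_mat p p \<and> (\<forall>x \<in> {0..<p} \<times> {0..<p}. A $$ x \<in> \<mu> $$ x)"
  using dims by (auto simp: contained_in_mat_def)

section \<open>Entries of the derived matrices\<close>

lemma entry:
  assumes "x \<in> {0..<p} \<times> {0..<p}"
  shows "closed (\<mu> $$ x)" "connected (\<mu> $$ x)" "\<mu> $$ x \<noteq> {}"
proof -
  have "\<mu> $$ x \<in> elements_mat \<mu>"
    using assms elements_matI[OF carrier, of "fst x" "snd x" "\<mu> $$ x"] by auto
  then show "closed (\<mu> $$ x)" "connected (\<mu> $$ x)" "\<mu> $$ x \<noteq> {}"
    using interval by (auto simp: general_closed_interval_mat_def)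
qed

lemma tilde_index:
  assumes "x \<in> {0..<p} \<times> {0..<p}"
  shows "\<tau> $$ x = (if \<mu> $$ x = UNIV then {0} else \<mu> $$ x)"
  using assms dims by (cases x) (simp add: tilde_mat_def)

lemma tilde_half:
  assumes "x \<in> H"
  shows "\<tau> $$ x = \<mu> $$ x" "half_bounded_entry (\<mu> $$ x)" "\<not> bounded_entry (\<mu> $$ x)"
proof -
  show h: "half_bounded_entry (\<mu> $$ x)"
    using assms by (simp add: H_def)
  then show "\<not> bounded_entry (\<mu> $$ x)" "\<tau> $$ x = \<mu> $$ x"
    using entry_kinds_disjoint assms H_subset tilde_index by auto
qed

text \<open>An unbounded entry becomes the constant 0, which it contains; every other entry outside
  \<open>H\<close> is bounded already.\<close>

lemma tilde_bounded:
  assumes "x \<in> {0..<p} \<times> {0..<p}" "x \<notin> H"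
  shows "bounded_entry (\<tau> $$ x)" "\<tau> $$ x \<subseteq> \<mu> $$ x"
proof -
  have "\<mu> $$ x = UNIV \<or> bounded_entry (\<mu> $$ x)"
    using closed_interval_cases[OF entry[OF assms(1)]] assms by (auto simp: H_def half_bounded_entry_def)
  then show "bounded_entry (\<tau> $$ x)" "\<tau> $$ x \<subseteq> \<mu> $$ x"
    using tilde_index[OF assms(1)] bounded_entry_singleton by auto
qed

lemma bar_index:
  assumes "x \<in> {0..<p} \<times> {0..<p}" "dim_row \<gamma> = p" "dim_col \<gamma> = p"
  shows "half_bounded_entry (\<gamma> $$ x) \<Longrightarrow> bar_mat \<gamma> $$ x = {endpoint (\<gamma> $$ x)}"
    and "bounded_entry (\<gamma> $$ x) \<Longrightarrow> bar_mat \<gamma> $$ x = \<gamma> $$ x"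
  using assms entry_kinds_disjoint(1)[of "\<gamma> $$ x"]
  by (cases x; auto simp: bar_mat_def endpoint_def half_bounded_entry_def)+

lemma bar_half:
  assumes "x \<in> H"
  shows "\<beta> $$ x = {endpoint (\<mu> $$ x)}" "endpoint (\<mu> $$ x) \<in> \<mu> $$ x"
  using bar_index(1)[of x \<tau>] tilde_half[OF assms] assms H_subset dims half_bounded_ray[of "\<mu> $$ x"] by auto

lemma bar_bounded:
  assumes "x \<in> {0..<p} \<times> {0..<p}" "x \<notin> H"
  shows "\<beta> $$ x = \<tau> $$ x"
  using bar_index(2)[of x \<tau>] tilde_bounded[OF assms] assms dims by auto

lemma bar_entry:
  assumes "x \<in> {0..<p} \<times> {0..<p}"
  shows "bounded_entry (\<beta> $$ x)" "\<beta> $$ x \<subseteq> \<mu> $$ x"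
  using bar_half[of x] bar_bounded[of x] tilde_bounded[of x] assms bounded_entry_singleton
  by (cases "x \<in> H"; simp)+

lemma vertex_bar_contained:
  assumes "vertex_mat \<beta> A"
  shows "contained_in_mat (real_mat A) \<mu>"
proof -
  have A: "dim_row A = p" "dim_col A = p"
    using assms dims by (auto simp: vertex_mat_def)
  have "the_elem (A $$ (i,j)) \<in> \<mu> $$ (i,j)" if "i < p" "j < p" for i j
    using vertex_matD(1)[OF assms, of i j] bar_entry[of "(i,j)"] that dims by auto
  then show ?thesis
    using A by (auto simp: contained_iff real_mat_def intro!: carrier_matI)
qed

text \<open>The determinant of this one contained matrix is the reference for the common
  sign.\<close>

lemma lower_contained: "contained_in_mat lower_vertex \<mu>"
proof -
  have "the_elem (if bounded_entry (\<beta> $$ x) then {Inf (\<beta> $$ x)} else \<beta> $$ x) \<in> \<mu> $$ x"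
    if "x \<in> {0..<p} \<times> {0..<p}" for x
    using bar_entry[OF that] bounded_entry_endpoints[of "\<beta> $$ x"] by auto
  then show ?thesis
    using dims by (auto simp: contained_iff real_mat_def lower_mat_def intro!: carrier_matI)
qed

lemma full_rank_iff: "full_rank_mat \<mu> \<longleftrightarrow> (\<forall>A. contained_in_mat A \<mu> \<longrightarrow> det A \<noteq> 0)"
proof -
  have "vec_space.rank (dim_row A) A = min (dim_row \<mu>) (dim_col \<mu>) \<longleftrightarrow> det A \<noteq> 0"
    if "contained_in_mat A \<mu>" for A
    using that vec_space.det_rank_iff[of A p] dims by (auto simp: contained_iff)
  then show ?thesis
    unfolding full_rank_mat_def by blast
qed

lemma same_sign:
  assumes "\<And>A. contained_in_mat A \<mu> \<Longrightarrow> det A \<noteq> 0"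
    and "contained_in_mat A \<mu>" "contained_in_mat B \<mu>"
  shows "det A * det B > 0"
  by (rule det_same_sign[where n = p and F = "\<lambda>x. \<mu> $$ x"]) (use assms entry(2) in \<open>auto simp: contained_iff\<close>)

section \<open>Unbounded entries and their cofactors\<close>

lemma unit_row_delete:
  assumes "A \<in> carrier_mat p p" "i < p" "j < p"
  shows "det (unit_rows A {(i,j)}) = (-1) ^ (i + j) * det (delete_rows_cols A {i} {j})"
  using det_unit_rows[of A p "[(i,j)]"] assms by (simp add: shift_sum_def shifted_index_def)

text \<open>If the cofactor of a free entry were nonzero, the determinant would be a nonconstant
  affine function of that entry and have a zero.\<close>

lemma unbounded_cofactor_zero:
  assumes nonsing: "\<And>A. contained_in_mat A \<mu> \<Longrightarrow> det A \<noteq> 0"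
    and ij: "i < p" "j < p" "\<mu> $$ (i,j) = UNIV"
    and B: "contained_in_mat B (delete_rows_cols \<mu> {i} {j})"
  shows "det B = 0"
proof (rule ccontr)
  assume nz: "det B \<noteq> 0"
  obtain A where A: "contained_in_mat A \<mu>" "delete_rows_cols A {i} {j} = B"
    by (rule delete_rows_cols_contained_extend[OF carrier _ _ _ B]) (use ij entry(3) in auto)
  have car: "A \<in> carrier_mat p p"
    using A(1) by (simp add: contained_iff)
  define c where "c = det (unit_rows A {(i,j)})"
  have "c \<noteq> 0"
    using unit_row_delete[OF car ij(1,2)] A(2) nz by (simp add: c_def)
  \<comment> \<open>The root of the determinant as a function of the entry at
    \<open>(i,j)\<close>.\<close>
  define v where "v = A $$ (i,j) - det A / c"
  have "contained_in_mat (upd_mat A (i,j) v) \<mu>"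
    using A(1) ij by (auto simp: contained_iff upd_mat_def)
  then have "det (upd_mat A (i,j) v) \<noteq> 0"
    by (rule nonsing)
  moreover have "det (upd_mat A (i,j) v) = det A + (v - A $$ (i,j)) * c"
    unfolding c_def by (rule det_upd_mat[OF car]) (use ij in auto)
  ultimately show False
    using \<open>c \<noteq> 0\<close> by (simp add: v_def)
qed

text \<open>An entry with zero cofactor does not affect the determinant. The unbounded entries are
  set to 0 one at a time; each intermediate matrix is still contained in \<open>\<mu>\<close>, so
  the hypothesis applies to its minors.\<close>

lemma det_zero_unbounded:
  assumes zero: "\<And>i j B. \<lbrakk>i < p; j < p; \<mu> $$ (i,j) = UNIV; contained_in_mat B (delete_rows_cols \<mu> {i} {j})\<rbrakk>
      \<Longrightarrow> det B = 0"
    and A: "contained_in_mat A \<mu>"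
  shows "det (mat p p (\<lambda>x. if \<mu> $$ x = UNIV then 0 else A $$ x)) = det A"
proof -
  define Z where "Z = (\<lambda>N. mat p p (\<lambda>x. if x \<in> N then 0 else A $$ x))"
  have cont: "contained_in_mat (Z N) \<mu>" if "\<forall>x\<in>N. \<mu> $$ x = UNIV" for N
    using A that by (auto simp: contained_iff Z_def)
  have "det (Z N) = det A" if "finite N" "N \<subseteq> {x \<in> {0..<p} \<times> {0..<p}. \<mu> $$ x = UNIV}" for N
    using that
  proof (induction N rule: finite_induct)
    case empty
    have "Z {} = A"
      using A by (auto simp: Z_def contained_iff)
    then show ?case by simp
  next
    case (insert x N)
    obtain i j where x: "x = (i,j)" "i < p" "j < p" "\<mu> $$ (i,j) = UNIV"
      using insert.prems by auto
    have "contained_in_mat (Z N) \<mu>"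
      using insert.prems by (intro cont) auto
    then have car: "Z N \<in> carrier_mat p p" and
      "contained_in_mat (delete_rows_cols (Z N) {i} {j}) (delete_rows_cols \<mu> {i} {j})"
      using delete_rows_cols_contained[OF carrier] x by (auto simp: contained_iff)
    then have "det (unit_rows (Z N) {x}) = 0"
      using zero[OF x(2-4)] unit_row_delete[OF car x(2,3)] by (simp add: x(1))
    moreover have "Z (insert x N) = upd_mat (Z N) x 0"
      by (intro eq_matI) (auto simp: Z_def upd_mat_def)
    ultimately have "det (Z (insert x N)) = det (Z N)"
      using det_upd_mat[OF car, of x 0] x by simp
    then show ?case
      using insert by simp
  qed
  moreover have "mat p p (\<lambda>x. if \<mu> $$ x = UNIV then 0 else A $$ x) =
      Z {x \<in> {0..<p} \<times> {0..<p}. \<mu> $$ x = UNIV}"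
    by (intro eq_matI) (auto simp: Z_def)
  ultimately show ?thesis by simp
qed

text \<open>The exponent splits into the Laplace sign of the deletions and the number of
  right-bounded entries, whose sign is the product of the directions. So this is the coefficient of
  the determinant in the nonnegative parameters of the half-bounded entries.\<close>

lemma sign_unit_rows:
  assumes "G \<in> carrier_mat p p" "ps \<noteq> []" "set ps \<subseteq> H" "distinct (map fst ps)" "distinct (map snd ps)"
  shows "(-1) ^ sign_exponent \<mu> ps * det (delete_rows_cols G (set (map fst ps)) (set (map snd ps))) =
    prod (\<lambda>x. direction (\<mu> $$ x)) (set ps) * det (unit_rows G (set ps))"
proof -
  have "distinct ps"
    using assms(4) by (simp add: distinct_map)
  have "prod (\<lambda>x. direction (\<mu> $$ x)) (set ps) =
      prod (\<lambda>x. if right_bounded_entry (\<mu> $$ x) then - 1 else 1) (set ps)"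
    by (simp add: direction_def)
  also have "\<dots> = (-1) ^ num_right_bounded \<mu> ps"
    unfolding num_right_bounded_eq[OF \<open>distinct ps\<close>]
    by (subst prod.inter_filter[symmetric]) auto
  finally have "prod (\<lambda>x. direction (\<mu> $$ x)) (set ps) = (-1) ^ num_right_bounded \<mu> ps" .
  moreover have "det (unit_rows G (set ps)) =
      (-1) ^ shift_sum ps * det (delete_rows_cols G (set (map fst ps)) (set (map snd ps)))"
    using assms H_subset by (intro det_unit_rows) auto
  moreover have "length ps \<ge> 1"
    using assms(2) by (cases ps) auto
  ultimately show ?thesis
    by (simp add: sign_exponent_eq power_add)
qed

section \<open>Vertices and the cones of half-bounded parameters over them\<close>

lemma vertex_tilde_half:
  assumes "vertex_mat \<tau> \<gamma>" "x \<in> H"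
  shows "real_mat (bar_mat \<gamma>) $$ x = endpoint (\<mu> $$ x)"
proof -
  obtain i j where x: "x = (i,j)" "i < p" "j < p"
    using assms(2) H_subset by auto
  have \<gamma>: "dim_row \<gamma> = p" "dim_col \<gamma> = p"
    using assms dims by (auto simp: vertex_mat_def)
  have "\<gamma> $$ (i,j) = \<mu> $$ (i,j)"
    using vertex_matD(2)[OF assms(1), of i j] x dims tilde_half[OF assms(2)] by auto
  then have "bar_mat \<gamma> $$ (i,j) = {endpoint (\<mu> $$ (i,j))}"
    using bar_index(1)[of "(i,j)" \<gamma>] x \<gamma> tilde_half[OF assms(2)] by auto
  moreover have "real_mat (bar_mat \<gamma>) $$ (i,j) = the_elem (bar_mat \<gamma> $$ (i,j))"
    using \<gamma> x by (simp add: real_mat_def bar_mat_def)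
  ultimately show ?thesis
    by (simp add: x)
qed

lemma vertex_tilde_bounded:
  assumes "vertex_mat \<tau> \<gamma>" "x \<in> {0..<p} \<times> {0..<p}" "x \<notin> H"
  shows "\<gamma> $$ x = {real_mat (bar_mat \<gamma>) $$ x}" "bar_mat \<gamma> $$ x = \<gamma> $$ x"
    "real_mat (bar_mat \<gamma>) $$ x \<in> \<tau> $$ x"
proof -
  obtain i j where x: "x = (i,j)" "i < p" "j < p"
    using assms(2) by auto
  have \<gamma>: "dim_row \<gamma> = p" "dim_col \<gamma> = p"
    using assms dims by (auto simp: vertex_mat_def)
  obtain v where v: "v \<in> \<tau> $$ x" "\<gamma> $$ x = {v}"
    using vertex_matD(1)[OF assms(1), of i j] x dims tilde_bounded[OF assms(2,3)] by auto
  then show b: "bar_mat \<gamma> $$ x = \<gamma> $$ x"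
    using bar_index(2)[OF assms(2) \<gamma>] bounded_entry_singleton by simp
  have "real_mat (bar_mat \<gamma>) $$ x = the_elem (bar_mat \<gamma> $$ x)"
    using \<gamma> x by (simp add: real_mat_def bar_mat_def)
  then show "\<gamma> $$ x = {real_mat (bar_mat \<gamma>) $$ x}" "real_mat (bar_mat \<gamma>) $$ x \<in> \<tau> $$ x"
    using b v by auto
qed

lemma vertex_tilde_carrier:
  assumes "vertex_mat \<tau> \<gamma>"
  shows "real_mat (bar_mat \<gamma>) \<in> carrier_mat p p"
  using assms dims by (auto simp: vertex_mat_def real_mat_def bar_mat_def intro!: carrier_matI)

lemma vertex_cone_contained:
  assumes \<gamma>: "vertex_mat \<tau> \<gamma>" and T: "\<And>x. T x \<ge> 0"
  shows "contained_in_mat (add_on (real_mat (bar_mat \<gamma>)) (\<lambda>x. direction (\<mu> $$ x) * T x) H) \<mu>"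
proof -
  let ?G = "real_mat (bar_mat \<gamma>)"
  have G: "?G \<in> carrier_mat p p"
    using vertex_tilde_carrier[OF \<gamma>] .
  have "?G $$ x + (if x \<in> H then direction (\<mu> $$ x) * T x else 0) \<in> \<mu> $$ x" if x: "x \<in> {0..<p} \<times> {0..<p}" for x
  proof (cases "x \<in> H")
    case True
    then show ?thesis
      using vertex_tilde_half[OF \<gamma> True] half_bounded_ray[OF tilde_half(2)[OF True]] T[of x] by simp
  next
    case False
    then show ?thesis
      using vertex_tilde_bounded(3)[OF \<gamma> x False] tilde_bounded[OF x False] by auto
  qed
  then show ?thesis
    using G by (auto simp: contained_iff add_on_def)
qed

text \<open>All matrices obtained from the vertex by nonnegative parameters are contained in
  \<open>\<mu>\<close>, so their determinants have the sign of \<open>det lower_vertex\<close>; the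
  coefficients inherit this sign or vanish.\<close>

lemma half_bounded_coefficient_nonneg:
  assumes nonsing: "\<And>A. contained_in_mat A \<mu> \<Longrightarrow> det A \<noteq> 0"
    and \<gamma>: "vertex_mat \<tau> \<gamma>"
    and ps: "ps \<noteq> []" "set ps \<subseteq> H" "distinct (map fst ps)" "distinct (map snd ps)"
  shows "(-1) ^ sign_exponent \<mu> ps * det lower_vertex *
    det (delete_rows_cols (real_mat (bar_mat \<gamma>)) (set (map fst ps)) (set (map snd ps))) \<ge> 0"
proof -
  let ?G = "real_mat (bar_mat \<gamma>)"
  have G: "?G \<in> carrier_mat p p"
    using vertex_tilde_carrier[OF \<gamma>] .
  have "det lower_vertex * prod (\<lambda>x. direction (\<mu> $$ x)) (set ps) * det (unit_rows ?G (set ps)) \<ge> 0"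
  proof (rule cone_coefficient_nonneg[OF G H_subset])
    show "det lower_vertex * det (add_on ?G (\<lambda>x. direction (\<mu> $$ x) * T x) H) \<ge> 0" if "\<And>x. T x \<ge> 0" for T
    proof -
      have "contained_in_mat (add_on ?G (\<lambda>x. direction (\<mu> $$ x) * T x) H) \<mu>"
        by (rule vertex_cone_contained[OF \<gamma> that])
      then show ?thesis
        using same_sign[OF nonsing lower_contained] by fastforce
    qed
    show "inj_on fst (set ps)"
      using ps(3) by (simp add: distinct_map)
  qed (rule ps(2))
  then show ?thesis
    using sign_unit_rows[OF G ps] by (simp add: mult_ac)
qed

text \<open>The vertex matrix selected by sign vectors \<open>y\<close> and \<open>z\<close> as in Rohn's criterion.\<close>

definition sign_vertex :: "(nat \<Rightarrow> bool) \<Rightarrow> (nat \<Rightarrow> bool) \<Rightarrow> real set mat" where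
  "sign_vertex y z = mat p p (\<lambda>(i,j).
     if (i,j) \<in> H then \<mu> $$ (i,j) else if y i = z j then {Sup (\<tau> $$ (i,j))} else {Inf (\<tau> $$ (i,j))})"

text \<open>At nonconstant bounded entries the minimum is chosen exactly where
  \<open>y i \<noteq> z j\<close>, which is the pattern of \<open>even_type_xor\<close>.\<close>

lemma sign_vertex_tilde: "vertex_mat \<tau> (sign_vertex y z)" "even_type \<tau> (sign_vertex y z)"
proof -
  have "(\<forall>m M. m \<le> M \<and> \<tau> $$ (i,j) = {m..M} \<longrightarrow> sign_vertex y z $$ (i,j) \<in> {{m}, {M}}) \<and>
      (\<not> bounded_entry (\<tau> $$ (i,j)) \<longrightarrow> sign_vertex y z $$ (i,j) = \<tau> $$ (i,j))" if ij: "i < p" "j < p" for i j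
  proof (cases "(i,j) \<in> H")
    case True
    then have "\<not> bounded_entry (\<tau> $$ (i,j))"
      using tilde_half by simp
    then show ?thesis
      using True ij tilde_half(1) unfolding bounded_entry_def by (auto simp: sign_vertex_def)
  next
    case False
    then show ?thesis
      using ij tilde_bounded[of "(i,j)"] by (auto simp: sign_vertex_def)
  qed
  then show "vertex_mat \<tau> (sign_vertex y z)"
    unfolding vertex_mat_def using dims by (simp add: sign_vertex_def)
  show "even_type \<tau> (sign_vertex y z)"
  proof (rule even_type_xor)
    fix i j assume "i < dim_row \<tau>" "j < dim_col \<tau>" and b: "bounded_entry (\<tau> $$ (i,j))"
      and nc: "\<not> constant_entry (\<tau> $$ (i,j))"
    then have ij: "i < p" "j < p" "(i,j) \<notin> H"
      using dims tilde_half by auto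
    \<comment> \<open>If the two ends coincided, the entry would be the minimum also where
      \<open>y i = z j\<close>.\<close>
    have "Inf (\<tau> $$ (i,j)) \<noteq> Sup (\<tau> $$ (i,j))"
      using nc bounded_entry_endpoints[OF b] unfolding constant_entry_def by (metis atLeastAtMost_singleton)
    then show "sign_vertex y z $$ (i,j) = {Inf (\<tau> $$ (i,j))} \<longleftrightarrow> y i \<noteq> z j"
      using ij by (auto simp: sign_vertex_def)
  qed
qed

text \<open>The bar turns the half-bounded entries of both matrices into the same endpoints and
  leaves the others alone. Hence one real matrix is governed both by the condition on
  \<open>\<beta>\<close> and by that on \<open>\<tau>\<close>.\<close>

lemma sign_vertex_bar: "vertex_mat \<beta> (bar_mat (sign_vertex y z))" "even_type \<beta> (bar_mat (sign_vertex y z))"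
proof -
  let ?\<gamma> = "sign_vertex y z"
  note vt = sign_vertex_tilde(1)[of y z]
  have d: "dim_row ?\<gamma> = p" "dim_col ?\<gamma> = p"
    by (simp_all add: sign_vertex_def)
  have bH: "bar_mat ?\<gamma> $$ x = \<beta> $$ x" if "x \<in> H" for x
  proof -
    have "?\<gamma> $$ x = \<mu> $$ x"
      using that H_subset by (auto simp: sign_vertex_def)
    then show ?thesis
      using bar_index(1)[OF _ d, of x] tilde_half[OF that] bar_half[OF that] that H_subset by auto
  qed
  have bB: "bar_mat ?\<gamma> $$ x = ?\<gamma> $$ x" "\<beta> $$ x = \<tau> $$ x" if "x \<in> {0..<p} \<times> {0..<p}" "x \<notin> H" for x
    using vertex_tilde_bounded(2)[OF vt that] bar_bounded[OF that] by auto
  have "(\<forall>m M. m \<le> M \<and> \<beta> $$ (i,j) = {m..M} \<longrightarrow> bar_mat ?\<gamma> $$ (i,j) \<in> {{m}, {M}}) \<and>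
      (\<not> bounded_entry (\<beta> $$ (i,j)) \<longrightarrow> bar_mat ?\<gamma> $$ (i,j) = \<beta> $$ (i,j))" if ij: "i < p" "j < p" for i j
  proof (cases "(i,j) \<in> H")
    case True
    have "{m..M} = {m}" if "m \<le> M" "{endpoint (\<mu> $$ (i,j))} = {m..M}" for m M
      using that by (metis atLeastAtMost_singleton_iff atLeastAtMost_singleton)
    then show ?thesis
      using bH[OF True] bar_half[OF True] by auto
  next
    case False
    then have "bar_mat ?\<gamma> $$ (i,j) = ?\<gamma> $$ (i,j)" "\<beta> $$ (i,j) = \<tau> $$ (i,j)"
      using bB[of "(i,j)"] ij by auto
    then show ?thesis
      using vt ij dims unfolding vertex_mat_def by metis
  qed
  then show "vertex_mat \<beta> (bar_mat ?\<gamma>)"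
    unfolding vertex_mat_def using dims d by (simp add: bar_mat_def)
  show "even_type \<beta> (bar_mat ?\<gamma>)"
  proof (rule even_type_xor)
    fix i j assume ij': "i < dim_row \<beta>" "j < dim_col \<beta>" and b: "bounded_entry (\<beta> $$ (i,j))"
      and nc: "\<not> constant_entry (\<beta> $$ (i,j))"
    then have ij: "i < p" "j < p" "(i,j) \<notin> H"
      using dims bar_half(1)[of "(i,j)"] by (auto simp: constant_entry_def)
    have "Inf (\<beta> $$ (i,j)) \<noteq> Sup (\<beta> $$ (i,j))"
      using nc bounded_entry_endpoints[OF b] unfolding constant_entry_def by (metis atLeastAtMost_singleton)
    then show "bar_mat ?\<gamma> $$ (i,j) = {Inf (\<beta> $$ (i,j))} \<longleftrightarrow> y i \<noteq> z j"
      using bB[of "(i,j)"] ij by (auto simp: sign_vertex_def)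
  qed
qed

text \<open>The half-bounded entries of \<open>A\<close> are kept, so that only bounded entries
  vary. At each sign pattern the determinant expands in the offsets of the half-bounded entries from
  their endpoints; after multiplication by \<open>det lower_vertex\<close> the constant term is
  positive by \<open>vert\<close> and the other terms are nonnegative by
  \<open>half\<close>.\<close>

lemma nonsingular_if_conditions:
  assumes zero: "\<And>i j B. \<lbrakk>i < p; j < p; \<mu> $$ (i,j) = UNIV; contained_in_mat B (delete_rows_cols \<mu> {i} {j})\<rbrakk>
      \<Longrightarrow> det B = 0"
    and vert: "\<And>A. \<lbrakk>vertex_mat \<beta> A; even_type \<beta> A\<rbrakk> \<Longrightarrow> det (real_mat A) * det lower_vertex > 0"
    and half: "\<And>\<gamma> ps. \<lbrakk>vertex_mat \<tau> \<gamma>; even_type \<tau> \<gamma>; ps \<noteq> []; set ps \<subseteq> H;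
        distinct (map fst ps); distinct (map snd ps)\<rbrakk> \<Longrightarrow>
      (-1) ^ sign_exponent \<mu> ps * det lower_vertex *
        det (delete_rows_cols (real_mat (bar_mat \<gamma>)) (set (map fst ps)) (set (map snd ps))) \<ge> 0"
    and A: "contained_in_mat A \<mu>"
  shows "det A \<noteq> 0"
proof -
  define A0 where "A0 = mat p p (\<lambda>x. if \<mu> $$ x = UNIV then 0 else A $$ x)"
  have A0\<tau>: "A0 $$ x \<in> \<tau> $$ x" if "x \<in> {0..<p} \<times> {0..<p}" for x
  proof -
    have "A $$ x \<in> \<mu> $$ x"
      using A that unfolding contained_iff by blast
    moreover have "A0 $$ x = (if \<mu> $$ x = UNIV then 0 else A $$ x)"
      using that by (cases x) (simp add: A0_def)
    ultimately show ?thesis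
      using tilde_index[OF that] by simp
  qed
  \<comment> \<open>On \<open>H\<close> the interval is degenerate, frozen at the entry of
    \<open>A0\<close>.\<close>
  define lo where "lo = (\<lambda>x. if x \<in> H then A0 $$ x else Inf (\<tau> $$ x))"
  define hi where "hi = (\<lambda>x. if x \<in> H then A0 $$ x else Sup (\<tau> $$ x))"
  have "det A0 \<noteq> 0"
  proof (rule interval_mat_nonsingular[where lo = lo and hi = hi and n = p and \<kappa> = "det lower_vertex"])
    show "A0 \<in> carrier_mat p p"
      by (simp add: A0_def)
    fix i j assume ij: "i < p" "j < p"
    show "lo (i,j) \<le> A0 $$ (i,j) \<and> A0 $$ (i,j) \<le> hi (i,j)"
    proof (cases "(i,j) \<in> H")
      case False
      then have "A0 $$ (i,j) \<in> {Inf (\<tau> $$ (i,j))..Sup (\<tau> $$ (i,j))}"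
        using A0\<tau>[of "(i,j)"] ij bounded_entry_endpoints(1)[OF tilde_bounded(1)[of "(i,j)"]] by auto
      then show ?thesis
        using False by (simp add: lo_def hi_def)
    qed (simp add: lo_def hi_def)
  next
    fix y z :: "nat \<Rightarrow> bool"
    define G where "G = real_mat (bar_mat (sign_vertex y z))"
    define T where "T = (\<lambda>x. A0 $$ x - endpoint (\<mu> $$ x))"
    let ?V = "mat p p (\<lambda>(i,j). if y i = z j then hi (i,j) else lo (i,j))"
    note vt = sign_vertex_tilde[of y z]
    have G: "G \<in> carrier_mat p p"
      unfolding G_def by (rule vertex_tilde_carrier[OF vt(1)])
    \<comment> \<open>On \<open>H\<close> the vertex \<open>G\<close> has the endpoint and
      \<open>T\<close> is the offset from it; elsewhere both sides pick the same end of the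
      interval.\<close>
    have "?V = add_on G T H"
    proof (rule eq_matI)
      fix i j assume "i < dim_row (add_on G T H)" "j < dim_col (add_on G T H)"
      then have ij: "i < p" "j < p"
        using G by (auto simp: add_on_def)
      show "?V $$ (i,j) = add_on G T H $$ (i,j)"
      proof (cases "(i,j) \<in> H")
        case True
        then show ?thesis
          using ij G vertex_tilde_half[OF vt(1) True] by (simp add: lo_def hi_def add_on_def T_def G_def[symmetric])
      next
        case False
        then have "{G $$ (i,j)} = sign_vertex y z $$ (i,j)"
          using vertex_tilde_bounded(1)[OF vt(1), of "(i,j)"] ij by (simp add: G_def)
        then show ?thesis
          using False ij G by (simp add: lo_def hi_def add_on_def sign_vertex_def split: if_splits)
      qed
    qed (use G in \<open>auto simp: add_on_def\<close>)
    then have det: "det ?V = (\<Sum>P | P \<subseteq> H \<and> inj_on fst P. prod T P * det (unit_rows G P))"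
      using det_add_on[OF finite_H H_subset G] by simp
    \<comment> \<open>The term for the empty set is the determinant of the vertex itself.\<close>
    have empty: "det lower_vertex * (prod T {} * det (unit_rows G {})) > 0"
      using vert[OF sign_vertex_bar] by (simp add: G_def mult.commute)
    have "det lower_vertex * (prod T P * det (unit_rows G P)) \<ge> 0" if P: "P \<subseteq> H" "inj_on fst P" for P
    proof (cases "P = {}")
      case True
      then show ?thesis using empty by simp
    next
      case ne: False
      show ?thesis
      proof (cases "inj_on snd P")
        case True
        obtain ps where ps: "set ps = P" "distinct (map fst ps)" "distinct (map snd ps)"
          using diagonal_set_list P(2) True finite_subset[OF P(1) finite_H] by blast
        \<comment> \<open>The nonnegative parameter of the entry. As \<open>direction\<close>
          squares to 1, the signs can be moved from the offsets into the coefficient.\<close>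
        define T' where "T' = (\<lambda>x. direction (\<mu> $$ x) * T x)"
        have "T x = direction (\<mu> $$ x) * T' x" for x
          by (simp add: T'_def)
        then have "prod T P = prod (\<lambda>x. direction (\<mu> $$ x)) P * prod T' P"
          by (simp add: prod.distrib)
        moreover have "prod T' P \<ge> 0"
        proof (rule prod_nonneg)
          fix x assume "x \<in> P"
          then have x: "x \<in> H" using P by auto
          then have "A0 $$ x \<in> \<mu> $$ x"
            using A0\<tau>[of x] H_subset tilde_half(1)[OF x] by auto
          then show "T' x \<ge> 0"
            using half_bounded_ray[OF tilde_half(2)[OF x]] by (simp add: T'_def T_def)
        qed
        moreover have "det lower_vertex * (prod (\<lambda>x. direction (\<mu> $$ x)) P * det (unit_rows G P)) \<ge> 0"
        proof -
          have "ps \<noteq> []" "set ps \<subseteq> H"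
            using ne ps(1) P by auto
          then show ?thesis
            using half[OF vt _ _ ps(2,3)] sign_unit_rows[OF G _ _ ps(2,3)]
            by (simp add: G_def[symmetric] ps(1) mult_ac)
        qed
        ultimately show ?thesis
          using mult_nonneg_nonneg[of "prod T' P" "det lower_vertex * (prod (\<lambda>x. direction (\<mu> $$ x)) P * det (unit_rows G P))"]
          by (simp add: mult_ac)
      next
        case False
        then show ?thesis
          using det_unit_rows_same_col[OF G _ P(2)] P(1) H_subset by auto
      qed
    qed
    then have "(\<Sum>P | P \<subseteq> H \<and> inj_on fst P. det lower_vertex * (prod T P * det (unit_rows G P))) > 0"
      using empty finite_H by (intro sum_pos2[where i = "{}"]) auto
    then show "det lower_vertex * det ?V > 0"
      by (simp add: det sum_distrib_left)
  qed
  \<comment> \<open>Restoring the unbounded entries of \<open>A\<close> does not change the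
    determinant.\<close>
  then show ?thesis
    using det_zero_unbounded[OF zero A] by (simp add: A0_def)
qed

end

section \<open>Full rank in terms of cofactors, vertices and minors\<close>

theorem theorem16:
  fixes p :: nat and \<mu> :: "real set mat"
  assumes "p \<ge> 1"
    and "\<mu> \<in> carrier_mat p p"
    and "general_closed_interval_mat \<mu>"
  shows "full_rank_mat \<mu> \<longleftrightarrow>
    (\<forall>i < p. \<forall>j < p. \<mu> $$ (i,j) = UNIV \<longrightarrow>
       (let \<nu> = delete_rows_cols \<mu> {i} {j} in
          (\<nexists>ps. pg_diagonal \<nu> ps \<and> totally_nonconstant \<nu> ps \<and> length ps = p - 1) \<and>
          (\<forall>ps. pg_diagonal \<nu> ps \<and> totally_nonconstant \<nu> ps \<and> length ps + 2 \<le> p \<longrightarrow>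
             detc (complementary_mat \<nu> ps) = 0))) \<and>
    (\<forall>A. vertex_mat (bar_mat (tilde_mat \<mu>)) A \<and> even_type (bar_mat (tilde_mat \<mu>)) A \<longrightarrow>
       Determinant.det (real_mat A) *
       Determinant.det (real_mat (lower_mat (bar_mat (tilde_mat \<mu>)))) > 0) \<and>
    (\<forall>\<gamma> ps. vertex_mat (tilde_mat \<mu>) \<gamma> \<and> even_type (tilde_mat \<mu>) \<gamma> \<and>
       length ps \<ge> 1 \<and> set ps \<subseteq> {0..<p} \<times> {0..<p} \<and>
       distinct (map fst ps) \<and> distinct (map snd ps) \<and>
       (\<forall>ij \<in> set ps. half_bounded_entry (\<mu> $$ ij)) \<longrightarrow>
       (-1) ^ sign_exponent \<mu> ps *
       Determinant.det (real_mat (lower_mat (bar_mat (tilde_mat \<mu>)))) *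
       Determinant.det (delete_rows_cols (real_mat (bar_mat \<gamma>))
         (set (map fst ps)) (set (map snd ps))) \<ge> 0)"
    (is "_ \<longleftrightarrow> ?C1 \<and> ?C2 \<and> ?C3")
proof -
  interpret square_interval_mat \<mu> p
    using assms by unfold_locales
  \<comment> \<open>The statement on pg-diagonals lists the coefficients of the cofactor of an
    unbounded entry; their vanishing is the vanishing of the cofactor on all contained
    matrices.\<close>
  have C1: "?C1 \<longleftrightarrow> (\<forall>i<p. \<forall>j<p. \<mu> $$ (i,j) = UNIV \<longrightarrow>
      (\<forall>B. contained_in_mat B (delete_rows_cols \<mu> {i} {j}) \<longrightarrow> det B = 0))"
  proof (intro all_cong imp_cong refl)
    fix i j assume ij: "i < p" "j < p"
    let ?\<nu> = "delete_rows_cols \<mu> {i} {j}"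
    have \<nu>: "?\<nu> \<in> carrier_mat (p - 1) (p - 1)"
      using delete_rows_cols_carrier[OF carrier, of "{i}" "{j}"] ij by simp
    have ne: "?\<nu> $$ x \<noteq> {}" if range: "x \<in> {0..<p-1} \<times> {0..<p-1}" for x
    proof -
      obtain a b where x: "x = (a,b)" "a < p - 1" "b < p - 1"
        using range by auto
      have "?\<nu> $$ x = \<mu> $$ (pick (- {i}) a, pick (- {j}) b)" "pick (- {i}) a < p" "pick (- {j}) b < p"
        using delete_rows_cols_index[OF carrier, of "{i}" "{j}" a b] x ij by auto
      then show ?thesis
        using entry(3) by simp
    qed
    \<comment> \<open>Both bounds describe the lengths from 0 to \<open>p - 2\<close>; for
      \<open>p = 1\<close> neither admits any.\<close>
    have len: "length ps + 2 \<le> p \<longleftrightarrow> length ps < p - 1" for ps :: "(nat \<times> nat) list"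
      by auto
    show "(let \<nu> = ?\<nu> in
          (\<nexists>ps. pg_diagonal \<nu> ps \<and> totally_nonconstant \<nu> ps \<and> length ps = p - 1) \<and>
          (\<forall>ps. pg_diagonal \<nu> ps \<and> totally_nonconstant \<nu> ps \<and> length ps + 2 \<le> p \<longrightarrow>
             detc (complementary_mat \<nu> ps) = 0)) \<longleftrightarrow>
        (\<forall>B. contained_in_mat B ?\<nu> \<longrightarrow> det B = 0)"
      unfolding Let_def len no_nonzero_coefficient_iff[OF \<nu>]
      by (rule det_zero_iff_no_nonzero_coefficient[OF \<nu> ne, symmetric])
  qed
  have subH: "set ps \<subseteq> H \<longleftrightarrow> set ps \<subseteq> {0..<p} \<times> {0..<p} \<and> (\<forall>ij \<in> set ps. half_bounded_entry (\<mu> $$ ij))" for ps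
    by (auto simp: H_def)
  have ne: "length ps \<ge> 1 \<longleftrightarrow> ps \<noteq> []" for ps :: "(nat \<times> nat) list"
    by (cases ps) auto
  show ?thesis
    unfolding full_rank_iff C1
  proof (intro iffI conjI)
    assume nonsing: "\<forall>A. contained_in_mat A \<mu> \<longrightarrow> det A \<noteq> 0"
    show "\<forall>i<p. \<forall>j<p. \<mu> $$ (i,j) = UNIV \<longrightarrow>
        (\<forall>B. contained_in_mat B (delete_rows_cols \<mu> {i} {j}) \<longrightarrow> det B = 0)"
      using unbounded_cofactor_zero nonsing by blast
    show ?C2
      using same_sign nonsing vertex_bar_contained lower_contained by blast
    show ?C3
    proof (intro allI impI, elim conjE)
      fix \<gamma> ps
      assume \<gamma>: "vertex_mat \<tau> \<gamma>" and ps: "length ps \<ge> 1" "set ps \<subseteq> {0..<p} \<times> {0..<p}"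
        "distinct (map fst ps)" "distinct (map snd ps)" "\<forall>ij \<in> set ps. half_bounded_entry (\<mu> $$ ij)"
      show "(-1) ^ sign_exponent \<mu> ps * det lower_vertex *
          det (delete_rows_cols (real_mat (bar_mat \<gamma>)) (set (map fst ps)) (set (map snd ps))) \<ge> 0"
      proof (rule half_bounded_coefficient_nonneg[OF _ \<gamma> _ _ ps(3,4)])
        show "ps \<noteq> []" "set ps \<subseteq> H"
          using ne[of ps] subH[of ps] ps by blast+
      qed (use nonsing in blast)
    qed
  next
    assume C: "(\<forall>i<p. \<forall>j<p. \<mu> $$ (i,j) = UNIV \<longrightarrow>
        (\<forall>B. contained_in_mat B (delete_rows_cols \<mu> {i} {j}) \<longrightarrow> det B = 0)) \<and> ?C2 \<and> ?C3"
    show "\<forall>A. contained_in_mat A \<mu> \<longrightarrow> det A \<noteq> 0"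
    proof (intro allI impI)
      fix A assume A: "contained_in_mat A \<mu>"
      show "det A \<noteq> 0"
      proof (rule nonsingular_if_conditions[OF _ _ _ A])
        show "det B = 0" if "i < p" "j < p" "\<mu> $$ (i,j) = UNIV"
          "contained_in_mat B (delete_rows_cols \<mu> {i} {j})" for i j B
          using C that by blast
        show "det (real_mat A) * det lower_vertex > 0" if "vertex_mat \<beta> A" "even_type \<beta> A" for A
          using C that by blast
        show "(-1) ^ sign_exponent \<mu> ps * det lower_vertex *
            det (delete_rows_cols (real_mat (bar_mat \<gamma>)) (set (map fst ps)) (set (map snd ps))) \<ge> 0"
          if \<gamma>: "vertex_mat \<tau> \<gamma>" "even_type \<tau> \<gamma>" and ps: "ps \<noteq> []" "set ps \<subseteq> H"
            "distinct (map fst ps)" "distinct (map snd ps)" for \<gamma> ps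
        proof -
          have "length ps \<ge> 1" "set ps \<subseteq> {0..<p} \<times> {0..<p}" "\<forall>ij \<in> set ps. half_bounded_entry (\<mu> $$ ij)"
            using ne[of ps] subH[of ps] ps by blast+
          then show ?thesis
            using C[THEN conjunct2, THEN conjunct2, rule_format, of \<gamma> ps] \<gamma> ps by blast
        qed
      qed
    qed
  qed
qed

end
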